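(* Let $N\ge2$, let $\mathcal{K}\subset\mathbb{R}^N$ be a convex body, let $\omega\in\mathbb{S}^{N-1}$, and let $f_\omega(y)=\frac{a_\omega(y)+b_\omega(y)}{2}$ for $y\in\mathcal{S}_\omega(\mathcal{K})$. Then $$ f_\omega(y)=\frac{i\displaystyle\int_{\omega^\perp}\partial_\omega\widehat{\mathcal{X}}_{\mathcal{K}}(\eta)\,e^{iy\cdot\eta}\,d\eta}{\displaystyle\int_{\omega^\perp}\widehat{\mathcal{X}}_{\mathcal{K}}(\eta)\,e^{iy\cdot\eta}\,d\eta},\qquad y\in\mathcal{S}_\omega(\mathcal{K}), $$ where $\widehat{\mathcal{X}}_{\mathcal{K}}$ denotes the Fourier transform of the characteristic function of $\mathcal{K}$ and $\partial_\omega$ denotes differentiation in the direction $\omega$.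
   Context: A convex body is a compact convex set with non-empty interior. $\mathbb{S}^{N-1}$ is the unit sphere, $\omega^\perp=\{x\in\mathbb{R}^N: x\cdot\omega=0\}$ and $\mathcal{P}_\omega(x)=x-(x\cdot\omega)\omega$. The shadow of $\mathcal{K}$ in the direction $\omega$ is $\mathcal{S}_\omega(\mathcal{K})=\mathcal{P}_\omega(\mathcal{K})\subset\omega^\perp$, and for $y\in\mathcal{S}_\omega(\mathcal{K})$, $a_\omega(y)=\min\{t\in\mathbb{R}: y+t\omega\in\mathcal{K}\}$ and $b_\omega(y)=\max\{t\in\mathbb{R}: y+t\omega\in\mathcal{K}\}$. The Fourier transform convention is $\widehat{\mathcal{X}}_{\mathcal{K}}(\xi)=\int_{\mathcal{K}}e^{-ix\cdot\xi}\,dx$, $\xi\in\mathbb{R}^N$. The integrals over the $(N-1)$-dimensional space $\omega^\perp$ are understood in the sense of the inversion formula for the Fourier transform on $\omega^\perp$.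
   Formalization: The integrals are taken as limits of Gauss means; the quotient formula is stated where a_ω(y)<b_ω(y), since where a_ω(y)=b_ω(y) (e.g. boundary of a ball's shadow) it reads 0/0; there f_ω(y) is given as the limit of the quotient of the Gauss means. *)

theory Defs
  imports "HOL-Analysis.Analysis"
begin

definition convex_body :: "'a::euclidean_space set \<Rightarrow> bool" where
  "convex_body K \<longleftrightarrow> compact K \<and> convex K \<and> interior K \<noteq> {}"

definition hyperplane :: "'a::euclidean_space \<Rightarrow> 'a set" where
  "hyperplane \<omega> = {x. x \<bullet> \<omega> = 0}"

definition hyperplane_proj :: "'a::euclidean_space \<Rightarrow> 'a \<Rightarrow> 'a" where
  "hyperplane_proj \<omega> x = x - (x \<bullet> \<omega>) *\<^sub>R \<omega>"

definition shadow :: "'a::euclidean_space \<Rightarrow> 'a set \<Rightarrow> 'a set" where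
  "shadow \<omega> K = hyperplane_proj \<omega> ` K"

definition lower_end :: "'a::euclidean_space \<Rightarrow> 'a set \<Rightarrow> 'a \<Rightarrow> real" where
  "lower_end \<omega> K y = (LEAST t. y + t *\<^sub>R \<omega> \<in> K)"

definition upper_end :: "'a::euclidean_space \<Rightarrow> 'a set \<Rightarrow> 'a \<Rightarrow> real" where
  "upper_end \<omega> K y = (GREATEST t. y + t *\<^sub>R \<omega> \<in> K)"

definition chord_mid :: "'a::euclidean_space \<Rightarrow> 'a set \<Rightarrow> 'a \<Rightarrow> real" where
  "chord_mid \<omega> K y = (lower_end \<omega> K y + upper_end \<omega> K y) / 2"

definition fourier_indicator :: "'a::euclidean_space set \<Rightarrow> 'a \<Rightarrow> complex" where
  "fourier_indicator K \<xi> = (LINT x:K|lborel. exp (- \<i> * complex_of_real (x \<bullet> \<xi>)))"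

definition dir_deriv :: "'a::euclidean_space \<Rightarrow> ('a \<Rightarrow> complex) \<Rightarrow> 'a \<Rightarrow> complex" where
  "dir_deriv \<omega> F \<xi> = vector_derivative (\<lambda>t. F (\<xi> + t *\<^sub>R \<omega>)) (at 0)"

definition orthonormal_basis_of :: "'a::euclidean_space set \<Rightarrow> 'a set \<Rightarrow> bool" where
  "orthonormal_basis_of V B \<longleftrightarrow> pairwise orthogonal B \<and> (\<forall>b\<in>B. norm b = 1) \<and> span B = V"

text \<open>Lebesgue measure of dimension \<open>dim V\<close> on a linear subspace \<open>V\<close>, transported from
  orthonormal coordinates. By rotation invariance it does not depend on the basis chosen.
  It is a measure on the ambient Borel sets that is concentrated on \<open>V\<close>.\<close>

definition subspace_lborel :: "'a::euclidean_space set \<Rightarrow> 'a measure" where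
  "subspace_lborel V =
    (let B = (SOME B. orthonormal_basis_of V B)
     in distr (\<Pi>\<^sub>M b\<in>B. lborel) borel (\<lambda>c. \<Sum>b\<in>B. c b *\<^sub>R b))"

text \<open>The Fourier transforms involved need not be absolutely integrable on the hyperplane, and
  in high dimension even their integrals over balls need not converge. The integral
  of \<open>\<phi>(\<eta>) exp(i y \<cdot> \<eta>)\<close> is therefore taken in the sense in which the Fourier inversion formula
  holds pointwise, namely as the limit of its Gauss means. As in the formula studied here, the
  factor \<open>(2 \<pi>) ^ (N - 1)\<close> is not divided out.\<close>

definition gauss_integrand ::
    "('a::euclidean_space \<Rightarrow> complex) \<Rightarrow> 'a \<Rightarrow> real \<Rightarrow> 'a \<Rightarrow> complex" where
  "gauss_integrand \<phi> y \<epsilon> \<eta> =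
    \<phi> \<eta> * exp (\<i> * complex_of_real (y \<bullet> \<eta>)) * complex_of_real (exp (- \<epsilon> * (norm \<eta>)\<^sup>2))"

definition gauss_mean ::
    "'a::euclidean_space \<Rightarrow> ('a \<Rightarrow> complex) \<Rightarrow> 'a \<Rightarrow> real \<Rightarrow> complex" where
  "gauss_mean \<omega> \<phi> y \<epsilon> = (LINT \<eta>|subspace_lborel (hyperplane \<omega>). gauss_integrand \<phi> y \<epsilon> \<eta>)"

definition inversion_integrable ::
    "'a::euclidean_space \<Rightarrow> ('a \<Rightarrow> complex) \<Rightarrow> 'a \<Rightarrow> bool" where
  "inversion_integrable \<omega> \<phi> y \<longleftrightarrow>
    (\<forall>\<epsilon>>0. integrable (subspace_lborel (hyperplane \<omega>)) (gauss_integrand \<phi> y \<epsilon>)) \<and>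
    (\<exists>I. (gauss_mean \<omega> \<phi> y \<longlongrightarrow> I) (at_right 0))"

definition inversion_integral ::
    "'a::euclidean_space \<Rightarrow> ('a \<Rightarrow> complex) \<Rightarrow> 'a \<Rightarrow> complex" where
  "inversion_integral \<omega> \<phi> y = Lim (at_right 0) (gauss_mean \<omega> \<phi> y)"

end

theory Submission
  imports Defs "HOL-Probability.Characteristic_Functions"
begin

text \<open>Write \<open>P\<close> for the orthogonal projection onto \<open>\<omega>\<^sup>\<bottom>\<close> and \<open>d = N - 1\<close>.
  Fubini's theorem and the Fourier transform of a Gaussian turn the Gauss means over the hyperplane
  into Gaussian averages over the body itself: the mean of \<open>fourier_indicator K\<close> at \<open>y\<close> is
  \<open>\<integral>\<^sub>K (\<pi>/\<epsilon>)\<^sup>d\<^sup>/\<^sup>2 exp (- \<bar>P (y - x)\<bar>\<^sup>2 / (4 \<epsilon>)) dx\<close>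
  (\<open>gauss_mean_fourier\<close>). Differentiating in the direction \<open>\<omega>\<close> multiplies the integrand of the
  Fourier transform by \<open>- \<i> (x \<bullet> \<omega>)\<close>, so that \<open>\<i>\<close> times the mean of the derivative is the
  same integral with the extra weight \<open>x \<bullet> \<omega>\<close>. The quotient of the two is the Gaussian average of
  the height \<open>x \<bullet> \<omega>\<close> over the points of \<open>K\<close> that lie close to the line through \<open>y\<close>.

  To pass to the limit, the hyperplane directions are blown up about \<open>y\<close> by the factor \<open>1 / (2 sqrt \<epsilon>)\<close>;
  the Jacobian cancels the powers of \<open>\<epsilon>\<close>, leaving a fixed Gaussian on the blown-up body. By convexity
  this body converges, up to a null set, to the product of the tangent cone of the shadow at \<open>y\<close>
  and the open chord over \<open>y\<close> (\<open>eventually_shrink_in_K_iff\<close>). Both means therefore converge,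
  at boundary points of the shadow as well (\<open>tendsto_gauss_moment\<close>). The limit region is symmetric
  about the middle of the chord, so its mean height is the midpoint (\<open>cone_moment_first\<close>), and
  it has positive Gaussian mass when the chord is not a point (\<open>cone_moment_pos\<close>). This gives the
  quotient formula for the two inversion integrals.

  When the chord is a single point both limits vanish, and the quotient of the means is treated
  directly: the part of \<open>K\<close> away from the line through \<open>y\<close> carries an exponentially
  small share of the Gaussian weight, and the part near that line lies, by compactness, near the
  degenerate chord (\<open>gauss_moment_ratio_degenerate\<close>).\<close>

section \<open>Rotation invariance and anisotropic scaling of Lebesgue measure\<close>

text \<open>The uniqueness proof for Haar measure: integrate \<open>indicator A x * indicator U (y - x)\<close> over both
  variables. Integrating over \<open>y\<close> first gives \<open>\<mu> A * lborel U\<close>; substituting \<open>x + y\<close> for \<open>x\<close> and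
  integrating over \<open>y\<close> first gives \<open>lborel A * \<mu> U\<close>, because the ball \<open>U\<close> is symmetric.
  The factors for \<open>U\<close> agree and cancel.\<close>
lemma translation_invariant_measure_eq_lborel:
  fixes \<mu> :: "'a::euclidean_space measure"
  assumes sets [measurable_cong]: "sets \<mu> = sets borel"
    and "sigma_finite_measure \<mu>"
    and invariant: "\<And>a. distr \<mu> borel ((+) a) = \<mu>"
    and ball: "emeasure \<mu> (ball 0 1) = emeasure lborel (ball (0::'a) 1)"
  shows "\<mu> = lborel"
proof (rule measure_eqI)
  show "sets \<mu> = sets lborel" using sets by simp
next
  fix A assume "A \<in> sets \<mu>"
  then have A [measurable]: "A \<in> sets borel" using sets by simp
  define U where "U = ball (0::'a) 1"
  have U [measurable]: "U \<in> sets borel" by (simp add: U_def)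
  have U_minus: "indicator U (- x) = (indicator U x :: ennreal)" for x
    by (simp add: U_def indicator_def dist_norm)
  interpret \<mu>: sigma_finite_measure \<mu> by fact
  interpret pair_sigma_finite \<mu> "lborel :: 'a measure" ..
  have shift_lborel: "(\<integral>\<^sup>+ y. f (a + y) \<partial>lborel) = (\<integral>\<^sup>+ y. f y \<partial>lborel)"
    if [measurable]: "f \<in> borel_measurable borel" for f and a :: 'a
    by (subst (2) lborel_distr_plus[of a, symmetric], subst nn_integral_distr) auto
  have shift_\<mu>: "(\<integral>\<^sup>+ x. f (a + x) \<partial>\<mu>) = (\<integral>\<^sup>+ x. f x \<partial>\<mu>)"
    if [measurable]: "f \<in> borel_measurable borel" for f a
    by (subst (2) invariant[of a, symmetric], subst nn_integral_distr) auto
  have "emeasure \<mu> A * emeasure lborel U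
      = (\<integral>\<^sup>+ x. indicator A x * emeasure lborel U \<partial>\<mu>)"
    by (simp add: nn_integral_multc)
  also have "\<dots> = (\<integral>\<^sup>+ x. indicator A x * (\<integral>\<^sup>+ y. indicator U (- x + y) \<partial>lborel) \<partial>\<mu>)"
    by (subst shift_lborel) auto
  also have "\<dots> = (\<integral>\<^sup>+ x. (\<integral>\<^sup>+ y. indicator A x * indicator U (- x + y) \<partial>lborel) \<partial>\<mu>)"
    by (subst nn_integral_cmult) auto
  also have "\<dots> = (\<integral>\<^sup>+ y. (\<integral>\<^sup>+ x. indicator A x * indicator U (- x + y) \<partial>\<mu>) \<partial>lborel)"
    by (rule Fubini'[symmetric]) measurable
  also have "\<dots> = (\<integral>\<^sup>+ y. (\<integral>\<^sup>+ x. indicator A (y + x) * indicator U (- (y + x) + y) \<partial>\<mu>) \<partial>lborel)"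
    by (intro nn_integral_cong shift_\<mu>[symmetric]) measurable
  also have "\<dots> = (\<integral>\<^sup>+ y. (\<integral>\<^sup>+ x. indicator A (x + y) * indicator U x \<partial>\<mu>) \<partial>lborel)"
    by (simp add: U_minus add.commute)
  also have "\<dots> = (\<integral>\<^sup>+ x. (\<integral>\<^sup>+ y. indicator A (x + y) * indicator U x \<partial>lborel) \<partial>\<mu>)"
    by (rule Fubini') measurable
  also have "\<dots> = (\<integral>\<^sup>+ x. emeasure lborel A * indicator U x \<partial>\<mu>)"
    by (subst nn_integral_multc, measurable, subst shift_lborel) auto
  also have "\<dots> = emeasure lborel A * emeasure lborel U"
    using ball by (subst nn_integral_cmult_indicator) (auto simp: U_def sets)
  finally have eq: "emeasure \<mu> A * emeasure lborel U = emeasure lborel A * emeasure lborel U" .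
  have "emeasure lborel U \<noteq> 0" "emeasure lborel U \<noteq> top"
    using emeasure_lborel_ball_finite[of "0::'a" 1]
      open_not_negligible[of U] by (auto simp: U_def negligible_iff_emeasure0)
  then show "emeasure \<mu> A = emeasure lborel A"
    using eq by (simp add: mult.commute[of _ "emeasure lborel U"] ennreal_mult_cancel_left)
qed

text \<open>The image measure is translation invariant because \<open>f\<close> is linear and onto, and it agrees with
  Lebesgue measure on centred balls because \<open>f\<close> preserves norms.\<close>
lemma orthogonal_transformation_distr_lborel:
  fixes f :: "'a::euclidean_space \<Rightarrow> 'a"
  assumes f: "orthogonal_transformation f"
  shows "distr lborel borel f = lborel"
proof (rule translation_invariant_measure_eq_lborel)
  have lin: "linear f" using f by (rule orthogonal_transformation_linear)
  have [measurable]: "f \<in> borel_measurable borel"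
    using linear_continuous_on[of f UNIV] lin
    by (intro borel_measurable_continuous_onI) (auto simp: linear_conv_bounded_linear)
  have ball: "emeasure (distr lborel borel f) (ball 0 r) = emeasure lborel (ball (0::'a) r)" for r
  proof -
    have "f -` ball 0 r = ball 0 r"
      using orthogonal_transformation_norm[OF f] by (auto simp: dist_norm)
    then show ?thesis by (simp add: emeasure_distr)
  qed
  then show "emeasure (distr lborel borel f) (ball 0 1) = emeasure lborel (ball (0::'a) 1)" .
  show "sets (distr lborel borel f) = sets borel" by simp
  show "sigma_finite_measure (distr lborel borel f)"
  proof
    have "(\<Union>n. ball (0::'a) (real n)) = UNIV"
      by (auto simp: dist_norm) (rule reals_Archimedean2)
    then show "\<exists>A. countable A \<and> A \<subseteq> sets (distr lborel borel f) \<and>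
        \<Union>A = space (distr lborel borel f) \<and> (\<forall>a\<in>A. emeasure (distr lborel borel f) a \<noteq> \<infinity>)"
      using emeasure_lborel_ball_finite[of "0::'a"]
      by (intro exI[of _ "range (\<lambda>n. ball (0::'a) (real n))"]) (auto simp: ball less_top)
  qed
  fix a
  obtain a' where a': "f a' = a"
    using orthogonal_transformation_surj[OF f] by (metis surjD)
  have "distr (distr lborel borel f) borel ((+) a) = distr lborel borel (\<lambda>x. f (a' + x))"
    by (subst distr_distr) (auto simp: o_def a' linear_add[OF lin])
  also have "\<dots> = distr (distr lborel borel ((+) a')) borel f"
    by (subst distr_distr) (auto simp: o_def)
  finally show "distr (distr lborel borel f) borel ((+) a) = distr lborel borel f"
    by (simp add: lborel_distr_plus)
qed

lemma orthogonal_transformation_reflection: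
  fixes u :: "'a::euclidean_space"
  assumes "norm u = 1"
  shows "orthogonal_transformation (\<lambda>x. x - (2 * (x \<bullet> u)) *\<^sub>R u)"
proof -
  have "u \<bullet> u = 1" using assms by (simp add: norm_eq_1)
  then show ?thesis
    unfolding orthogonal_transformation_def
    by (auto intro!: linearI simp: algebra_simps inner_simps inner_commute)
qed

text \<open>The Householder reflection along \<open>a - b\<close> exchanges \<open>a\<close> and \<open>b\<close>.\<close>
lemma orthogonal_transformation_exists_unit:
  fixes a b :: "'a::euclidean_space"
  assumes "norm a = 1" "norm b = 1"
  obtains f where "orthogonal_transformation f" "f a = b"
proof (cases "a = b")
  case True
  then show ?thesis using that[of id] by (simp add: id_def)
next
  case False
  define u where "u = (a - b) /\<^sub>R norm (a - b)"
  have u: "norm u = 1" using False by (simp add: u_def)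
  have 1: "2 * (a \<bullet> (a - b)) = (norm (a - b))\<^sup>2"
    using assms unfolding power2_norm_eq_inner
    by (simp add: inner_simps norm_eq_1 inner_commute)
  have "(2 * (a \<bullet> u)) *\<^sub>R u = (2 * (a \<bullet> (a - b)) / (norm (a - b))\<^sup>2) *\<^sub>R (a - b)"
    by (simp add: u_def power2_eq_square divide_inverse mult_ac)
  also have "\<dots> = a - b" using False by (subst 1) simp
  finally have "a - (2 * (a \<bullet> u)) *\<^sub>R u = b" by simp
  then show ?thesis
    using that[OF orthogonal_transformation_reflection[OF u]] by simp
qed

lemma borel_measurable_hyperplane_proj [measurable]:
  "hyperplane_proj \<omega> \<in> borel_measurable borel"
  unfolding hyperplane_proj_def[abs_def] by measurable

text \<open>Up to a translation, the map scales the \<open>DIM('a) - 1\<close> directions orthogonal to \<open>\<omega>\<close> by \<open>\<delta>\<close> and fixes \<open>\<omega>\<close>. An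
  orthogonal map that carries a coordinate vector to \<open>\<omega>\<close> conjugates it to a diagonal map.\<close>
lemma lborel_stretch_hyperplane:
  fixes \<omega> :: "'a::euclidean_space"
  assumes \<omega>: "norm \<omega> = 1" and \<delta>: "\<delta> > 0"
  shows "lborel = density
    (distr lborel borel (\<lambda>x. y + \<delta> *\<^sub>R hyperplane_proj \<omega> x + (x \<bullet> \<omega>) *\<^sub>R \<omega>))
    (\<lambda>_. ennreal (\<delta> ^ (DIM('a) - 1)))"
proof -
  obtain e :: 'a where e: "e \<in> Basis" by (metis all_not_in_conv nonempty_Basis)
  obtain f where f: "orthogonal_transformation f" and fe: "f e = \<omega>"
    using orthogonal_transformation_exists_unit[of e \<omega>] e \<omega> by auto
  have lin: "linear f" using f by (rule orthogonal_transformation_linear)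
  interpret f: linear f by fact
  have f_meas [measurable]: "f \<in> borel_measurable borel"
    using linear_continuous_on[of f UNIV] lin
    by (intro borel_measurable_continuous_onI) (auto simp: linear_conv_bounded_linear)
  have fl: "distr lborel borel f = lborel" using f by (rule orthogonal_transformation_distr_lborel)
  define c where "c j = (if j = e then 1 else \<delta>)" for j :: 'a
  obtain t where t: "f t = y" using orthogonal_transformation_surj[OF f] by (metis surjD)
  define T where "T x = t + (\<Sum>j\<in>Basis. (c j * (x \<bullet> j)) *\<^sub>R j)" for x
  have T_meas [measurable]: "T \<in> borel_measurable borel" by (simp add: T_def[abs_def])
  have T: "T x = t + \<delta> *\<^sub>R x + ((1 - \<delta>) * (x \<bullet> e)) *\<^sub>R e" for x
  proof -
    have "(\<Sum>j\<in>Basis. (c j * (x \<bullet> j)) *\<^sub>R j)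
        = (\<Sum>j\<in>Basis. \<delta> *\<^sub>R ((x \<bullet> j) *\<^sub>R j) + (if j = e then ((1 - \<delta>) * (x \<bullet> e)) *\<^sub>R e else 0))"
      by (rule sum.cong) (auto simp: c_def algebra_simps)
    also have "\<dots> = \<delta> *\<^sub>R x + ((1 - \<delta>) * (x \<bullet> e)) *\<^sub>R e"
      using e by (simp add: sum.distrib euclidean_representation
          del: scaleR_scaleR flip: scaleR_sum_right)
    finally show ?thesis by (simp add: T_def)
  qed
  have c: "(\<Prod>j\<in>Basis. \<bar>c j\<bar>) = \<delta> ^ (DIM('a) - 1)"
    using e \<delta> by (subst prod.remove[OF _ e]) (auto simp: c_def card_Diff_singleton)
  have inner: "f x \<bullet> \<omega> = x \<bullet> e" for x
    using f by (metis fe orthogonal_transformation_def)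
  let ?A = "\<lambda>x. y + \<delta> *\<^sub>R hyperplane_proj \<omega> x + (x \<bullet> \<omega>) *\<^sub>R \<omega>"
  have fT: "f (T x) = ?A (f x)" for x
    by (simp add: T f.add f.diff f.scale fe t inner hyperplane_proj_def algebra_simps)
  have 1: "distr lborel borel ?A = distr (distr lborel borel T) borel f"
  proof -
    have "distr lborel borel ?A = distr (distr lborel borel f) borel ?A" by (simp add: fl)
    also have "\<dots> = distr lborel borel (\<lambda>x. f (T x))"
      by (subst distr_distr) (auto simp: o_def fT)
    also have "\<dots> = distr (distr lborel borel T) borel f"
      by (subst distr_distr) (auto simp: o_def)
    finally show ?thesis .
  qed
  have L: "lborel = density (distr lborel borel T) (\<lambda>_. ennreal (\<delta> ^ (DIM('a) - 1)))"
    using lborel_affine_euclidean[of c t] \<delta> unfolding c T_def by (simp add: c_def)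
  have "distr lborel borel f
      = distr (density (distr lborel borel T) (\<lambda>_. ennreal (\<delta> ^ (DIM('a) - 1)))) borel f"
    by (rule arg_cong[OF L, of "\<lambda>M. distr M borel f"])
  also have "\<dots> = density (distr (distr lborel borel T) borel f) (\<lambda>_. ennreal (\<delta> ^ (DIM('a) - 1)))"
    by (subst density_distr) auto
  finally show ?thesis unfolding fl 1 .
qed

lemma lborel_integral_stretch_hyperplane:
  fixes \<omega> :: "'a::euclidean_space" and f :: "'a \<Rightarrow> real"
  assumes "norm \<omega> = 1" and "\<delta> > 0" and [measurable]: "f \<in> borel_measurable borel"
  shows "(LINT x|lborel. f x) = \<delta> ^ (DIM('a) - 1) *
    (LINT x|lborel. f (y + \<delta> *\<^sub>R hyperplane_proj \<omega> x + (x \<bullet> \<omega>) *\<^sub>R \<omega>))"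
  using assms(2)
  by (subst lborel_stretch_hyperplane[OF assms(1,2), of y])
     (simp add: integral_density integral_distr)

section \<open>The Gauss mean of a Fourier transform\<close>

text \<open>The characteristic function of the standard normal distribution, rescaled by \<open>sqrt (2 \<epsilon>)\<close>.\<close>
lemma gaussian_fourier:
  assumes \<epsilon>: "\<epsilon> > 0"
  shows "integrable lborel (\<lambda>x::real. exp (\<i> * complex_of_real (x * s)) * complex_of_real (exp (- \<epsilon> * x\<^sup>2)))"
    and "(LINT x|lborel. exp (\<i> * complex_of_real (x * s)) * complex_of_real (exp (- \<epsilon> * x\<^sup>2)))
      = complex_of_real (sqrt (pi / \<epsilon>) * exp (- s\<^sup>2 / (4 * \<epsilon>)))"
proof -
  define c where "c = sqrt (2 * \<epsilon>)"
  have c: "c > 0" "c\<^sup>2 = 2 * \<epsilon>" using \<epsilon> by (auto simp: c_def)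
  define h where "h x = exp (\<i> * complex_of_real (x * s)) * complex_of_real (exp (- \<epsilon> * x\<^sup>2))" for x :: real
  define g where "g x = std_normal_density x *\<^sub>R exp (\<i> * complex_of_real (s / c * x))" for x :: real
  have gh: "g (0 + c * x) = complex_of_real (1 / sqrt (2 * pi)) * h x" for x
  proof -
    have "(c * x)\<^sup>2 / 2 = \<epsilon> * x\<^sup>2" using c by (simp add: power_mult_distrib)
    moreover have "s / c * (c * x) = x * s" using c by simp
    ultimately show ?thesis
      by (simp add: g_def h_def std_normal_density_def scaleR_conv_of_real mult_ac)
  qed
  have g_int: "integrable lborel g"
  proof (rule Bochner_Integration.integrable_bound)
    show "integrable lborel std_normal_density" by simp
    show "g \<in> borel_measurable lborel" unfolding g_def[abs_def] by measurable
  qed (auto simp: g_def)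
  have "integrable lborel (\<lambda>x. g (0 + c * x))"
    using c by (intro lborel_integrable_real_affine g_int) auto
  then have "integrable lborel (\<lambda>x. complex_of_real (sqrt (2 * pi)) * (complex_of_real (1 / sqrt (2 * pi)) * h x))"
    unfolding gh by (rule integrable_mult_right)
  then have "integrable lborel h" by (simp flip: of_real_mult mult.assoc)
  then show "integrable lborel (\<lambda>x::real. exp (\<i> * complex_of_real (x * s)) * complex_of_real (exp (- \<epsilon> * x\<^sup>2)))"
    by (simp add: h_def[abs_def])
  have "(LINT x|lborel. g x) = (CLINT x|std_normal_distribution. iexp (s / c * x))"
    unfolding g_def by (subst integral_density) auto
  also have "\<dots> = complex_of_real (exp (- (s / c)\<^sup>2 / 2))"
    using fun_cong[OF char_std_normal_distribution, of "s / c"] by (simp add: char_def)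
  also have "- (s / c)\<^sup>2 / 2 = - s\<^sup>2 / (4 * \<epsilon>)" using c by (simp add: power_divide)
  finally have 1: "(LINT x|lborel. g x) = complex_of_real (exp (- s\<^sup>2 / (4 * \<epsilon>)))" .
  have "(LINT x|lborel. g x) = c *\<^sub>R (LINT x|lborel. g (0 + c * x))"
    using c by (subst lborel_integral_real_affine[of c _ 0]) auto
  also have "\<dots> = complex_of_real (c / sqrt (2 * pi)) * (LINT x|lborel. h x)"
    unfolding gh by (simp add: scaleR_conv_of_real)
  finally have "(LINT x|lborel. h x) = complex_of_real (sqrt (2 * pi) / c) * (LINT x|lborel. g x)"
    using c by (simp add: field_simps)
  moreover have "sqrt (2 * pi) / c = sqrt (pi / \<epsilon>)"
    using \<epsilon> by (simp add: c_def flip: real_sqrt_divide)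
  ultimately show "(LINT x|lborel. exp (\<i> * complex_of_real (x * s)) * complex_of_real (exp (- \<epsilon> * x\<^sup>2)))
      = complex_of_real (sqrt (pi / \<epsilon>) * exp (- s\<^sup>2 / (4 * \<epsilon>)))"
    by (simp add: 1 h_def)
qed

definition fourier :: "('a::euclidean_space \<Rightarrow> complex) \<Rightarrow> 'a \<Rightarrow> complex" where
  "fourier g \<xi> = (LINT x|lborel. g x * exp (- \<i> * complex_of_real (x \<bullet> \<xi>)))"

lemma borel_measurable_fourier:
  fixes g :: "'a::euclidean_space \<Rightarrow> complex"
  assumes [measurable]: "g \<in> borel_measurable borel"
  shows "fourier g \<in> borel_measurable borel"
  unfolding fourier_def[abs_def] by measurable

lemma orthonormal_basis_of_hyperplane:
  fixes \<omega> :: "'a::euclidean_space"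
  assumes "norm \<omega> = 1" and "orthonormal_basis_of (hyperplane \<omega>) B"
  shows "finite B" and "card B = DIM('a) - 1"
    and "x \<in> hyperplane \<omega> \<Longrightarrow> (\<Sum>b\<in>B. (x \<bullet> b)\<^sup>2) = (norm x)\<^sup>2"
    and "norm (\<Sum>b\<in>B. c b *\<^sub>R b) ^ 2 = (\<Sum>b\<in>B. (c b)\<^sup>2)"
proof -
  have B: "pairwise orthogonal B" "\<And>b. b \<in> B \<Longrightarrow> norm b = 1" "span B = hyperplane \<omega>"
    using assms(2) by (auto simp: orthonormal_basis_of_def)
  have ind: "independent B"
    using B(1,2) by (intro pairwise_orthogonal_independent) force+
  then show fin: "finite B" by (rule independent_imp_finite)
  have "hyperplane \<omega> = {x. \<omega> \<bullet> x = 0}" by (auto simp: hyperplane_def inner_commute)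
  then have "dim (hyperplane \<omega>) = DIM('a) - 1" using dim_hyperplane[of \<omega>] assms(1) by force
  then show "card B = DIM('a) - 1" using B(3) ind by (metis dim_eq_card_independent dim_span)
  have BB: "b \<bullet> b' = (if b = b' then 1 else 0)" if "b \<in> B" "b' \<in> B" for b b'
    using B(1,2) that by (auto simp: pairwise_def orthogonal_def norm_eq_1)
  show n: "norm (\<Sum>b\<in>B. c b *\<^sub>R b) ^ 2 = (\<Sum>b\<in>B. (c b)\<^sup>2)" for c
    unfolding power2_norm_eq_inner using fin
    by (simp add: inner_sum_left inner_sum_right BB power2_eq_square
        if_distrib[of "\<lambda>x. _ * x"] cong: if_cong sum.cong)
  assume "x \<in> hyperplane \<omega>"
  then have "(\<Sum>b\<in>B. (x \<bullet> b) *\<^sub>R b) = x"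
    using orthonormal_basis_expand[OF B(1,2) _ fin, of x] B(3) by (simp add: inner_commute)
  then show "(\<Sum>b\<in>B. (x \<bullet> b)\<^sup>2) = (norm x)\<^sup>2" using n[of "\<lambda>b. x \<bullet> b"] by simp
qed

lemma hyperplane_proj_in_hyperplane: "norm \<omega> = 1 \<Longrightarrow> hyperplane_proj \<omega> x \<in> hyperplane \<omega>"
  by (simp add: hyperplane_proj_def hyperplane_def inner_diff_left norm_eq_1)

text \<open>Up to the factor \<open>(2 \<pi>)\<^sup>d\<close>, with \<open>d = DIM('a) - 1\<close>, this is the heat kernel of the hyperplane
  at time \<open>\<epsilon>\<close>, extended to be constant in the direction \<open>\<omega>\<close>.\<close>
definition heat :: "'a::euclidean_space \<Rightarrow> real \<Rightarrow> 'a \<Rightarrow> real" where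
  "heat \<omega> \<epsilon> v = sqrt (pi / \<epsilon>) ^ (DIM('a) - 1) * exp (- (norm (hyperplane_proj \<omega> v))\<^sup>2 / (4 * \<epsilon>))"

text \<open>In orthonormal coordinates the Gaussian integral over the hyperplane is a product of
  one-dimensional ones. The damping factor makes the double integral absolutely convergent for
  integrable \<open>g\<close>, so the order of integration may be exchanged.\<close>
lemma gauss_mean_fourier:
  fixes \<omega> :: "'a::euclidean_space" and g :: "'a \<Rightarrow> complex"
  assumes \<omega>: "norm \<omega> = 1" and g: "integrable lborel g" and \<epsilon>: "\<epsilon> > 0"
  shows "integrable (subspace_lborel (hyperplane \<omega>)) (gauss_integrand (fourier g) y \<epsilon>)" (is ?int)
    and "gauss_mean \<omega> (fourier g) y \<epsilon> = (LINT x|lborel. g x * complex_of_real (heat \<omega> \<epsilon> (y - x)))" (is ?eq)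
proof -
  define B where "B = (SOME B. orthonormal_basis_of (hyperplane \<omega>) B)"
  have "\<exists>B. orthonormal_basis_of (hyperplane \<omega>) B"
  proof -
    have "subspace (hyperplane \<omega>)"
      by (auto simp: subspace_def hyperplane_def inner_add_left)
    then show ?thesis
      by (rule orthonormal_basis_subspace) (auto simp: orthonormal_basis_of_def)
  qed
  then have "orthonormal_basis_of (hyperplane \<omega>) B" unfolding B_def by (rule someI_ex)
  note B = orthonormal_basis_of_hyperplane[OF \<omega> this]
  have B_perp: "\<omega> \<bullet> b = 0" if "b \<in> B" for b
    using \<open>orthonormal_basis_of (hyperplane \<omega>) B\<close> span_base[OF that]
    by (auto simp: orthonormal_basis_of_def hyperplane_def inner_commute)
  have fin [simp]: "finite B" by (rule B)
  have g_meas [measurable]: "g \<in> borel_measurable borel" using g by auto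
  note [measurable] = borel_measurable_fourier[OF g_meas]
  define M where "M = (\<Pi>\<^sub>M b\<in>B. (lborel :: real measure))"
  interpret product_sigma_finite "\<lambda>_. lborel :: real measure" by standard
  interpret finite_product_sigma_finite "\<lambda>_. lborel :: real measure" B by standard simp
  interpret M: sigma_finite_measure M unfolding M_def by (rule sigma_finite_measure_axioms)
  interpret pair_sigma_finite M "lborel :: 'a measure" ..
  define \<Phi> where "\<Phi> c = (\<Sum>b\<in>B. c b *\<^sub>R b)" for c :: "'a \<Rightarrow> real"
  have \<Phi> [measurable]: "\<Phi> \<in> M \<rightarrow>\<^sub>M borel" unfolding \<Phi>_def[abs_def] M_def by measurable
  have sl: "subspace_lborel (hyperplane \<omega>) = distr M borel \<Phi>"
    by (simp add: subspace_lborel_def Let_def B_def M_def \<Phi>_def[abs_def])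
  have int_meas [measurable]: "gauss_integrand (fourier g) y \<epsilon> \<in> borel_measurable borel"
    unfolding gauss_integrand_def[abs_def] by measurable

  \<comment> \<open>The damped exponential \<open>exp (\<i> v \<bullet> \<eta> - \<epsilon> \<bar>\<eta>\<bar>\<^sup>2)\<close> in the coordinates \<open>c\<close> of \<open>\<eta> = \<Phi> c\<close>.\<close>
  define k where "k v c = (\<Prod>b\<in>B. exp (\<i> * complex_of_real (c b * (v \<bullet> b)))
      * complex_of_real (exp (- \<epsilon> * (c b)\<^sup>2)))" for v :: 'a and c
  have k: "k v c = exp (\<i> * complex_of_real (v \<bullet> \<Phi> c)) * complex_of_real (exp (- \<epsilon> * (norm (\<Phi> c))\<^sup>2))" for v c
  proof -
    have "exp (\<i> * complex_of_real (v \<bullet> \<Phi> c)) = (\<Prod>b\<in>B. exp (\<i> * complex_of_real (c b * (v \<bullet> b))))"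
      by (simp add: \<Phi>_def inner_sum_right sum_distrib_left exp_sum)
    moreover have "exp (- \<epsilon> * (norm (\<Phi> c))\<^sup>2) = (\<Prod>b\<in>B. exp (- \<epsilon> * (c b)\<^sup>2))"
      by (simp add: \<Phi>_def B(4) sum_distrib_left exp_sum flip: sum_negf)
    ultimately show ?thesis by (simp add: k_def prod.distrib)
  qed
  have k_int: "integrable M (k v)" for v
    unfolding k_def[abs_def] M_def
    by (intro product_integrable_prod gaussian_fourier \<epsilon>) simp
  have k_norm: "norm (k v c) = exp (- \<epsilon> * (norm (\<Phi> c))\<^sup>2)" for v c
    by (simp add: k norm_mult)
  have k_meas [measurable]: "(\<lambda>(c, x). k (y - x) c) \<in> borel_measurable (M \<Otimes>\<^sub>M borel)"
    unfolding k by measurable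
  have k_lint: "(LINT c|M. k (y - x) c) = complex_of_real (heat \<omega> \<epsilon> (y - x))" for x
  proof -
    let ?v = "y - x"
    have b: "?v \<bullet> b = hyperplane_proj \<omega> ?v \<bullet> b" if "b \<in> B" for b
      using B_perp[OF that] by (simp add: hyperplane_proj_def inner_simps)
    have "(\<Sum>b\<in>B. (?v \<bullet> b)\<^sup>2) = (norm (hyperplane_proj \<omega> ?v))\<^sup>2"
      using B(3)[OF hyperplane_proj_in_hyperplane[OF \<omega>], of ?v] b by simp
    moreover have "(LINT c|M. k ?v c) = (\<Prod>b\<in>B. complex_of_real (sqrt (pi / \<epsilon>) * exp (- (?v \<bullet> b)\<^sup>2 / (4 * \<epsilon>))))"
      unfolding k_def M_def gaussian_fourier(2)[OF \<epsilon>, symmetric]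
      by (rule product_integral_prod, rule fin, rule gaussian_fourier(1)[OF \<epsilon>])
    moreover have "\<dots> = complex_of_real (sqrt (pi / \<epsilon>) ^ card B * exp (- (\<Sum>b\<in>B. (?v \<bullet> b)\<^sup>2) / (4 * \<epsilon>)))"
      by (simp add: prod.distrib exp_sum sum_divide_distrib flip: sum_negf)
    ultimately show ?thesis by (simp add: heat_def B(2))
  qed

  have gk_int: "integrable (M \<Otimes>\<^sub>M lborel) (\<lambda>(c, x). g x * k (y - x) c)"
  proof (rule Fubini_integrable)
    show "(\<lambda>(c, x). g x * k (y - x) c) \<in> borel_measurable (M \<Otimes>\<^sub>M lborel)"
      by measurable
    have "integrable M (\<lambda>c. (LINT x|lborel. norm (g x)) * norm (k 0 c))"
      by (intro integrable_mult_right integrable_norm k_int)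
    then show "integrable M (\<lambda>c. LINT x|lborel. norm (case (c, x) of (c, x) \<Rightarrow> g x * k (y - x) c))"
      by (simp add: norm_mult k_norm)
    show "AE c in M. integrable lborel (\<lambda>x. case (c, x) of (c, x) \<Rightarrow> g x * k (y - x) c)"
    proof (intro AE_I2)
      fix c assume [measurable]: "c \<in> space M"
      have "integrable lborel (\<lambda>x. norm (g x) * exp (- \<epsilon> * (norm (\<Phi> c))\<^sup>2))"
        using g by (intro integrable_mult_left integrable_norm)
      then show "integrable lborel (\<lambda>x. case (c, x) of (c, x) \<Rightarrow> g x * k (y - x) c)"
        by (rule Bochner_Integration.integrable_bound) (auto simp: norm_mult k_norm k)
    qed
  qed
  have gi: "gauss_integrand (fourier g) y \<epsilon> (\<Phi> c) = (LINT x|lborel. g x * k (y - x) c)" for c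
  proof -
    have "gauss_integrand (fourier g) y \<epsilon> (\<Phi> c)
        = (LINT x|lborel. g x * exp (- \<i> * complex_of_real (x \<bullet> \<Phi> c))
            * (exp (\<i> * complex_of_real (y \<bullet> \<Phi> c)) * complex_of_real (exp (- \<epsilon> * (norm (\<Phi> c))\<^sup>2))))"
      unfolding gauss_integrand_def fourier_def
      by (subst integral_mult_left_zero) (simp only: mult.assoc)
    also have "\<dots> = (LINT x|lborel. g x * k (y - x) c)"
      by (intro Bochner_Integration.integral_cong refl)
        (simp add: k inner_diff_left exp_diff exp_minus ring_distribs divide_inverse mult_ac)
    finally show ?thesis .
  qed
  show ?int
    unfolding sl using integrable_fst[OF gk_int]
    by (subst integrable_distr_eq) (auto simp: gi)
  have "gauss_mean \<omega> (fourier g) y \<epsilon> = (LINT c|M. LINT x|lborel. g x * k (y - x) c)"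
    unfolding gauss_mean_def sl by (subst integral_distr) (auto simp: gi)
  also have "\<dots> = (LINT x|lborel. LINT c|M. g x * k (y - x) c)"
    by (rule Fubini_integral[symmetric]) (use gk_int in simp)
  also have "\<dots> = (LINT x|lborel. g x * complex_of_real (heat \<omega> \<epsilon> (y - x)))"
    by (simp add: k_lint)
  finally show ?eq .
qed

lemma fourier_indicator_eq_fourier:
  "fourier_indicator K = fourier (indicator K)"
  unfolding fourier_indicator_def[abs_def] fourier_def[abs_def] set_lebesgue_integral_def
  by (simp add: scaleR_conv_of_real of_real_indicator)

text \<open>Differentiation under the integral sign: on the bounded set \<open>K\<close> the estimate
  \<open>\<bar>exp (\<i> \<theta>) - 1 - \<i> \<theta>\<bar> \<le> \<theta>\<^sup>2\<close> holds with \<open>\<theta> = - t (x \<bullet> \<omega>)\<close>, and integrating it makes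
  the difference quotient differ from the claimed derivative by \<open>O(t)\<close>.\<close>
lemma dir_deriv_fourier_indicator:
  fixes K :: "'a::euclidean_space set"
  assumes K: "compact K"
  shows "dir_deriv \<omega> (fourier_indicator K)
    = fourier (\<lambda>x. - \<i> * complex_of_real (indicator K x * (x \<bullet> \<omega>)))"
proof
  fix \<xi> :: 'a
  have K_meas [measurable]: "K \<in> sets borel" using K by (simp add: borel_compact)
  have K_fin: "integrable lborel (indicator K :: 'a \<Rightarrow> real)"
    using emeasure_bounded_finite[OF compact_imp_bounded[OF K]]
    by (subst integrable_indicator_iff) (auto simp: less_top)
  obtain R where R: "\<And>x. x \<in> K \<Longrightarrow> norm x \<le> R"
    using compact_imp_bounded[OF K] by (auto simp: bounded_iff)
  have bnd_int: "integrable lborel f" if [measurable]: "f \<in> borel_measurable borel"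
    and "\<And>x. norm (f x) \<le> c * indicator K x" for f :: "'a \<Rightarrow> complex" and c
  proof (rule Bochner_Integration.integrable_bound)
    show "integrable lborel (\<lambda>x. c * indicator K x :: real)"
      using K_fin by (rule integrable_mult_right)
    show "AE x in lborel. norm (f x) \<le> norm (c * indicator K x :: real)"
      using that(2) unfolding real_norm_def by (intro AE_I2 order_trans[OF _ abs_ge_self])
  qed simp
  define D where "D = fourier (\<lambda>x. - \<i> * complex_of_real (indicator K x * (x \<bullet> \<omega>))) \<xi>"
  define e where "e \<xi> x = exp (- \<i> * complex_of_real (x \<bullet> \<xi>))" for \<xi> x :: 'a
  have e_norm: "norm (e \<xi> x) = 1" for \<xi> x by (simp add: e_def)
  have e_meas [measurable]: "e \<xi> \<in> borel_measurable borel" for \<xi>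
    unfolding e_def[abs_def] by measurable
  define C where "C = (R * norm \<omega>)\<^sup>2 * measure lborel K"
  have D_int: "integrable lborel (\<lambda>x. - \<i> * complex_of_real (indicator K x * (x \<bullet> \<omega>)) * e \<xi> x)"
  proof (rule bnd_int)
    fix x
    show "norm (- \<i> * complex_of_real (indicator K x * (x \<bullet> \<omega>)) * e \<xi> x) \<le> (R * norm \<omega>) * indicator K x"
    proof (cases "x \<in> K")
      case True
      have "\<bar>x \<bullet> \<omega>\<bar> \<le> norm x * norm \<omega>" by (rule Cauchy_Schwarz_ineq2)
      also have "\<dots> \<le> R * norm \<omega>" using R[OF True] by (intro mult_right_mono) auto
      finally show ?thesis using True by (simp add: norm_mult e_norm)
    qed simp
  qed measurable
  have bound: "norm (fourier_indicator K (\<xi> + t *\<^sub>R \<omega>) - fourier_indicator K \<xi> - t *\<^sub>R D) \<le> C * t\<^sup>2" for t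
  proof -
    have F: "fourier_indicator K \<xi> = (LINT x|lborel. indicator K x * e \<xi> x)" for \<xi>
      by (simp add: fourier_indicator_eq_fourier fourier_def e_def)
    have D: "D = (LINT x|lborel. - \<i> * complex_of_real (indicator K x * (x \<bullet> \<omega>)) * e \<xi> x)"
      by (simp only: D_def fourier_def e_def)
    have F_int: "integrable lborel (\<lambda>x. indicator K x * e \<xi> x)" for \<xi>
      by (rule bnd_int[where c=1]) (auto simp: norm_mult e_norm indicator_def)
    have "fourier_indicator K (\<xi> + t *\<^sub>R \<omega>) - fourier_indicator K \<xi> - t *\<^sub>R D
        = (LINT x|lborel. indicator K x * e (\<xi> + t *\<^sub>R \<omega>) x - indicator K x * e \<xi> x
            - t *\<^sub>R (- \<i> * complex_of_real (indicator K x * (x \<bullet> \<omega>)) * e \<xi> x))"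
      using F_int D_int by (simp add: F D)
    also have "norm \<dots> \<le> (LINT x|lborel. (R * norm \<omega>)\<^sup>2 * t\<^sup>2 * indicator K x)"
    proof (rule Bochner_Integration.integral_norm_bound_integral)
      show "integrable lborel (\<lambda>x. indicator K x * e (\<xi> + t *\<^sub>R \<omega>) x - indicator K x * e \<xi> x
            - t *\<^sub>R (- \<i> * complex_of_real (indicator K x * (x \<bullet> \<omega>)) * e \<xi> x))"
        using F_int D_int by (intro Bochner_Integration.integrable_diff integrable_scaleR_right)
      show "integrable lborel (\<lambda>x. (R * norm \<omega>)\<^sup>2 * t\<^sup>2 * indicator K x)"
        using K_fin by (intro integrable_mult_right)
      fix x
      show "norm (indicator K x * e (\<xi> + t *\<^sub>R \<omega>) x - indicator K x * e \<xi> x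
            - t *\<^sub>R (- \<i> * complex_of_real (indicator K x * (x \<bullet> \<omega>)) * e \<xi> x))
          \<le> (R * norm \<omega>)\<^sup>2 * t\<^sup>2 * indicator K x"
      proof (cases "x \<in> K")
        case True
        define \<theta> where "\<theta> = - (t * (x \<bullet> \<omega>))"
        have "e (\<xi> + t *\<^sub>R \<omega>) x = e \<xi> x * iexp \<theta>"
          by (simp add: e_def \<theta>_def inner_add_right ring_distribs exp_diff exp_minus divide_inverse exp_add)
        then have "indicator K x * e (\<xi> + t *\<^sub>R \<omega>) x - indicator K x * e \<xi> x
            - t *\<^sub>R (- \<i> * complex_of_real (indicator K x * (x \<bullet> \<omega>)) * e \<xi> x)
            = e \<xi> x * (iexp \<theta> - (1 + \<i> * \<theta>))"
          using True by (simp add: \<theta>_def scaleR_conv_of_real algebra_simps)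
        also have "norm \<dots> = norm (iexp \<theta> - (1 + \<i> * \<theta>))" by (simp add: norm_mult e_norm)
        also have "\<dots> \<le> \<theta>\<^sup>2"
        proof -
          have "2 * norm (iexp \<theta> - (1 + \<i> * \<theta>)) \<le> \<theta>\<^sup>2"
            using iexp_approx1[of \<theta> 1] by (simp add: power2_eq_square)
          then show ?thesis using norm_ge_zero[of "iexp \<theta> - (1 + \<i> * \<theta>)"] by linarith
        qed
        also have "\<dots> = \<bar>x \<bullet> \<omega>\<bar>\<^sup>2 * t\<^sup>2" by (simp add: \<theta>_def power_mult_distrib)
        also have "\<dots> \<le> (R * norm \<omega>)\<^sup>2 * t\<^sup>2"
        proof (intro mult_right_mono power_mono)
          have "\<bar>x \<bullet> \<omega>\<bar> \<le> norm x * norm \<omega>" by (rule Cauchy_Schwarz_ineq2)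
          also have "\<dots> \<le> R * norm \<omega>" using R[OF True] by (intro mult_right_mono) auto
          finally show "\<bar>x \<bullet> \<omega>\<bar> \<le> R * norm \<omega>" .
        qed auto
        finally show ?thesis using True by simp
      qed simp
    qed
    also have "\<dots> = C * t\<^sup>2" using K_fin by (simp add: C_def mult_ac)
    finally show ?thesis .
  qed
  have "((\<lambda>t. fourier_indicator K (\<xi> + t *\<^sub>R \<omega>)) has_vector_derivative D) (at 0)"
    unfolding has_vector_derivative_def has_derivative_at
  proof (intro conjI bounded_linear_scaleR_left)
    show "(\<lambda>h. norm (fourier_indicator K (\<xi> + (0 + h) *\<^sub>R \<omega>) - fourier_indicator K (\<xi> + 0 *\<^sub>R \<omega>) - h *\<^sub>R D) / norm h) \<midarrow>0\<rightarrow> 0"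
    proof (rule Lim_null_comparison)
      show "((\<lambda>h. C * \<bar>h\<bar>) \<longlongrightarrow> 0) (at (0::real))"
        by (rule tendsto_eq_intros refl)+ simp
      have "norm (norm (fourier_indicator K (\<xi> + (0 + h) *\<^sub>R \<omega>) - fourier_indicator K (\<xi> + 0 *\<^sub>R \<omega>) - h *\<^sub>R D) / norm h) \<le> C * \<bar>h\<bar>"
        for h :: real
        using bound[of h] by (cases "h = 0") (auto simp: field_simps power2_eq_square abs_mult_self_eq
          simp flip: abs_mult)
      then show "\<forall>\<^sub>F h in at 0. norm (norm (fourier_indicator K (\<xi> + (0 + h) *\<^sub>R \<omega>) - fourier_indicator K (\<xi> + 0 *\<^sub>R \<omega>) - h *\<^sub>R D) / norm h) \<le> C * \<bar>h\<bar>"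
        by (auto intro: always_eventually)
    qed
  qed
  then show "dir_deriv \<omega> (fourier_indicator K) \<xi> = fourier (\<lambda>x. - \<i> * complex_of_real (indicator K x * (x \<bullet> \<omega>))) \<xi>"
    unfolding dir_deriv_def D_def by (rule vector_derivative_at)
qed

lemma integrable_exp_minus_norm_square:
  "integrable lborel (\<lambda>x::'a::euclidean_space. exp (- (norm x)\<^sup>2))"
proof -
  interpret product_sigma_finite "\<lambda>_. lborel :: real measure" by standard
  have 1: "integrable lborel (\<lambda>x::real. exp (- x\<^sup>2))"
    using integrable_norm[OF gaussian_fourier(1)[of 1 0]] by (simp add: norm_mult)
  have "integrable (\<Pi>\<^sub>M b\<in>(Basis::'a set). (lborel :: real measure)) (\<lambda>c. \<Prod>b\<in>Basis. exp (- (c b)\<^sup>2))"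
    by (rule product_integrable_prod) (simp_all add: 1)
  moreover have "(\<Prod>b\<in>Basis. exp (- (c b)\<^sup>2)) = exp (- (norm (\<Sum>b\<in>(Basis::'a set). c b *\<^sub>R b))\<^sup>2)" for c
  proof -
    have "(norm (\<Sum>b\<in>(Basis::'a set). c b *\<^sub>R b))\<^sup>2 = (\<Sum>b\<in>(Basis::'a set). (c b)\<^sup>2)"
      unfolding power2_norm_eq_inner
      by (subst euclidean_inner) (simp add: power2_eq_square)
    then show ?thesis by (simp add: exp_sum flip: sum_negf)
  qed
  ultimately show ?thesis
    by (subst lborel_eq, subst integrable_distr_eq) simp_all
qed

lemma tendsto_exp_minus_divide_at_right_0:
  assumes "c > (0::real)"
  shows "((\<lambda>\<epsilon>. exp (- c / \<epsilon>)) \<longlongrightarrow> 0) (at_right 0)"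
proof -
  have "filterlim (\<lambda>\<epsilon>. - c * inverse \<epsilon>) at_bot (at_right (0::real))"
    by (rule filterlim_tendsto_neg_mult_at_bot[OF tendsto_const _ filterlim_inverse_at_top_right])
      (use assms in simp)
  then show ?thesis
    using filterlim_compose[OF exp_at_bot] by (simp add: divide_inverse)
qed

section \<open>Chords and the tangent cone of the shadow\<close>

lemma hyperplane_proj_linear: "linear (hyperplane_proj \<omega>)"
  by (rule linearI) (auto simp: hyperplane_proj_def algebra_simps inner_simps)

lemma norm_hyperplane_proj:
  assumes "norm \<omega> = 1"
  shows "(norm (hyperplane_proj \<omega> x))\<^sup>2 = (norm x)\<^sup>2 - (x \<bullet> \<omega>)\<^sup>2"
  using assms unfolding power2_norm_eq_inner
  by (simp add: hyperplane_proj_def inner_simps norm_eq_1 inner_commute power2_eq_square)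

locale shadow_point =
  fixes K :: "'a::euclidean_space set" and \<omega> y :: 'a
  assumes body: "convex_body K" and unit: "norm \<omega> = 1" and y_shadow: "y \<in> shadow \<omega> K"
begin

abbreviation "P \<equiv> hyperplane_proj \<omega>"
abbreviation "a \<equiv> lower_end \<omega> K y"
abbreviation "b \<equiv> upper_end \<omega> K y"

sublocale P: linear P by (rule hyperplane_proj_linear)

lemma \<omega>\<omega> [simp]: "\<omega> \<bullet> \<omega> = 1" using unit by (simp add: norm_eq_1)

lemma P_inner [simp]: "P x \<bullet> \<omega> = 0"
  by (simp add: hyperplane_proj_def inner_simps)

lemma P_\<omega> [simp]: "P \<omega> = 0" by (simp add: hyperplane_proj_def)

lemma P_id: "x \<bullet> \<omega> = 0 \<Longrightarrow> P x = x" by (simp add: hyperplane_proj_def)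

lemma P_P [simp]: "P (P x) = P x" by (rule P_id) simp

lemma K: "compact K" "convex K" "interior K \<noteq> {}" "closed K"
  using body by (auto simp: convex_body_def compact_imp_closed)

lemma K_meas [measurable]: "K \<in> sets borel" using K(1) by (simp add: borel_compact)

lemma shadow_iff: "z \<in> shadow \<omega> K \<longleftrightarrow> z \<bullet> \<omega> = 0 \<and> (\<exists>s. z + s *\<^sub>R \<omega> \<in> K)"
proof
  assume "z \<in> shadow \<omega> K"
  then obtain x where "x \<in> K" "z = P x" by (auto simp: shadow_def)
  then have "z + (x \<bullet> \<omega>) *\<^sub>R \<omega> \<in> K" "z \<bullet> \<omega> = 0"
    by (simp_all add: hyperplane_proj_def inner_simps)
  then show "z \<bullet> \<omega> = 0 \<and> (\<exists>s. z + s *\<^sub>R \<omega> \<in> K)" by blast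
next
  assume "z \<bullet> \<omega> = 0 \<and> (\<exists>s. z + s *\<^sub>R \<omega> \<in> K)"
  then obtain s where s: "z \<bullet> \<omega> = 0" "z + s *\<^sub>R \<omega> \<in> K" by blast
  have "z = P (z + s *\<^sub>R \<omega>)" using s(1) by (simp add: P.add P.scale P_id)
  then show "z \<in> shadow \<omega> K" using s(2) unfolding shadow_def by blast
qed

lemma y_perp [simp]: "y \<bullet> \<omega> = 0" using y_shadow by (simp add: shadow_iff)

lemma P_y [simp]: "P y = y" by (simp add: P_id)

definition height_bound where "height_bound = (SOME r. \<forall>x\<in>K. norm x \<le> r)"

lemma height_bound: "x \<in> K \<Longrightarrow> \<bar>x \<bullet> \<omega>\<bar> \<le> height_bound"
proof -
  assume x: "x \<in> K"
  have "\<exists>r. \<forall>x\<in>K. norm x \<le> r" using compact_imp_bounded[OF K(1)] by (auto simp: bounded_iff)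
  then have "\<forall>x\<in>K. norm x \<le> height_bound" unfolding height_bound_def by (rule someI_ex)
  then show ?thesis using Cauchy_Schwarz_ineq2[of x \<omega>] x unit by force
qed

lemma chord: "a \<le> b" "y + t *\<^sub>R \<omega> \<in> K \<longleftrightarrow> a \<le> t \<and> t \<le> b"
proof -
  define C where "C = {t. y + t *\<^sub>R \<omega> \<in> K}"
  have ne: "C \<noteq> {}" using y_shadow by (auto simp: C_def shadow_iff)
  have "closed C"
  proof -
    have "C = (\<lambda>t. y + t *\<^sub>R \<omega>) -` K" by (auto simp: C_def)
    then show ?thesis using K(4) by (auto intro!: closed_vimage continuous_intros)
  qed
  moreover have "bounded C"
  proof -
    have "norm t \<le> height_bound" if "t \<in> C" for t
      using height_bound[of "y + t *\<^sub>R \<omega>"] that by (simp add: C_def inner_simps)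
    then show ?thesis by (auto simp: bounded_iff)
  qed
  ultimately have cpt: "compact C" by (simp add: compact_eq_bounded_closed)
  obtain m where m: "m \<in> C" "\<forall>t\<in>C. m \<le> t" using compact_attains_inf[OF cpt ne] by blast
  obtain M where M: "M \<in> C" "\<forall>t\<in>C. t \<le> M" using compact_attains_sup[OF cpt ne] by blast
  have am: "a = m" unfolding lower_end_def using m by (intro Least_equality) (auto simp: C_def)
  have bM: "b = M" unfolding upper_end_def using M by (intro Greatest_equality) (auto simp: C_def)
  show "a \<le> b" using am bM m M by auto
  have "is_interval C"
  proof -
    have "convex C"
    proof (rule convexI)
      fix s t u v :: real
      assume *: "s \<in> C" "t \<in> C" "0 \<le> u" "0 \<le> v" "u + v = 1"
      have "u *\<^sub>R (y + s *\<^sub>R \<omega>) + v *\<^sub>R (y + t *\<^sub>R \<omega>) \<in> K"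
        using K(2) * by (auto intro: convexD simp: C_def)
      also have "u *\<^sub>R (y + s *\<^sub>R \<omega>) + v *\<^sub>R (y + t *\<^sub>R \<omega>) = (u + v) *\<^sub>R y + (u * s + v * t) *\<^sub>R \<omega>"
        by (simp add: algebra_simps)
      finally show "u *\<^sub>R s + v *\<^sub>R t \<in> C" using *(5) by (simp add: C_def)
    qed
    then show ?thesis by (simp add: is_interval_convex_1)
  qed
  then have "t \<in> C" if "m \<le> t" "t \<le> M" using that m M mem_is_interval_1_I by blast
  then show "y + t *\<^sub>R \<omega> \<in> K \<longleftrightarrow> a \<le> t \<and> t \<le> b"
    using m M unfolding am bM by (auto simp: C_def)
qed

text \<open>The preimage of \<open>K\<close> is \<open>K\<close> blown up by \<open>1 / \<delta>\<close> about the line through \<open>y\<close>, heights unchanged.\<close>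
definition shrink :: "real \<Rightarrow> 'a \<Rightarrow> 'a" where "shrink \<delta> u = y + \<delta> *\<^sub>R P u + (u \<bullet> \<omega>) *\<^sub>R \<omega>"

lemma shrink_inner [simp]: "shrink \<delta> u \<bullet> \<omega> = u \<bullet> \<omega>" by (simp add: shrink_def inner_simps)

lemma shrink_meas [measurable]: "shrink \<delta> \<in> borel_measurable borel" unfolding shrink_def[abs_def] by measurable

text \<open>The directions from \<open>y\<close> into the shadow, pulled back along \<open>P\<close>. As the shadow is convex and
  contains \<open>y\<close>, the factors \<open>1 / (n + 1)\<close> reach every such direction; a countable union of closed
  sets is visibly Borel.\<close>
definition tangent_cone :: "'a set" where
  "tangent_cone = {u. \<exists>n::nat. y + (1 / real (Suc n)) *\<^sub>R P u \<in> shadow \<omega> K}"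

definition cone_slab :: "'a set" where "cone_slab = {u \<in> tangent_cone. a < u \<bullet> \<omega> \<and> u \<bullet> \<omega> < b}"

lemma cone_slab_meas [measurable]: "cone_slab \<in> sets borel"
proof -
  have "continuous_on K P" unfolding hyperplane_proj_def by (intro continuous_intros)
  then have "compact (shadow \<omega> K)" unfolding shadow_def using K(1) by (rule compact_continuous_image)
  then have [measurable]: "shadow \<omega> K \<in> sets borel" by (simp add: borel_compact)
  show ?thesis unfolding cone_slab_def tangent_cone_def mem_Collect_eq by measurable
qed

text \<open>Points outside the closed chord are excluded because \<open>K\<close> is closed. For heights strictly inside
  the chord, convexity decides: if the segment from \<open>y\<close> in direction \<open>P u\<close> starts inside the shadow, the
  shrunk point is eventually a convex combination of a chord point and one fixed point of \<open>K\<close>; if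
  it does not, the shrunk point never lies in \<open>K\<close>. At the two ends of the chord this
  can fail, but those heights form a null set.\<close>
lemma eventually_shrink_in_K_iff:
  assumes "u \<bullet> \<omega> \<noteq> a" "u \<bullet> \<omega> \<noteq> b"
  shows "\<forall>\<^sub>F \<delta> in at_right 0. shrink \<delta> u \<in> K \<longleftrightarrow> u \<in> cone_slab"
proof -
  let ?t = "u \<bullet> \<omega>"
  consider "\<not> (a \<le> ?t \<and> ?t \<le> b)" | "a < ?t" "?t < b" "u \<notin> tangent_cone" | "a < ?t" "?t < b" "u \<in> tangent_cone"
    using assms by fastforce
  then show ?thesis
  proof cases
    case 1
    have "((\<lambda>\<delta>. shrink \<delta> u) \<longlongrightarrow> y + 0 *\<^sub>R P u + ?t *\<^sub>R \<omega>) (at_right 0)"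
      unfolding shrink_def by (intro tendsto_intros)
    moreover have "y + 0 *\<^sub>R P u + ?t *\<^sub>R \<omega> \<in> - K" using 1 chord(2)[of ?t] by auto
    ultimately have "\<forall>\<^sub>F \<delta> in at_right 0. shrink \<delta> u \<in> - K"
      using topological_tendstoD[OF _ open_Compl[OF K(4)]] by blast
    then show ?thesis by (rule eventually_mono) (use 1 in \<open>auto simp: cone_slab_def\<close>)
  next
    case 2
    have "shrink \<delta> u \<notin> K" if \<delta>: "\<delta> > 0" for \<delta>
    proof
      assume in_K: "shrink \<delta> u \<in> K"
      obtain n :: nat where n: "1 / real (Suc n) < \<delta>"
        using reals_Archimedean[OF \<delta>] by (auto simp: inverse_eq_divide)
      define \<mu> where "\<mu> = 1 / real (Suc n) / \<delta>"
      have \<mu>: "0 \<le> \<mu>" "\<mu> \<le> 1" "\<mu> * \<delta> = 1 / real (Suc n)" using n \<delta> by (auto simp: \<mu>_def field_simps)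
      have "y + ?t *\<^sub>R \<omega> \<in> K" using 2 chord(2)[of ?t] by simp
      then have "(1 - \<mu>) *\<^sub>R (y + ?t *\<^sub>R \<omega>) + \<mu> *\<^sub>R shrink \<delta> u \<in> K"
        using K(2) in_K \<mu> by (intro convexD) auto
      also have "(1 - \<mu>) *\<^sub>R (y + ?t *\<^sub>R \<omega>) + \<mu> *\<^sub>R shrink \<delta> u = y + (\<mu> * \<delta>) *\<^sub>R P u + ?t *\<^sub>R \<omega>"
        by (simp add: shrink_def algebra_simps)
      finally have "y + (1 / real (Suc n)) *\<^sub>R P u \<in> shadow \<omega> K"
        unfolding \<mu>(3) shadow_iff by (auto simp: inner_simps)
      then show False using 2 by (auto simp: tangent_cone_def)
    qed
    then have "\<forall>\<^sub>F \<delta> in at_right 0. shrink \<delta> u \<notin> K"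
      using eventually_at_right_less[of "0::real"] by (auto elim: eventually_mono)
    then show ?thesis by (rule eventually_mono) (use 2 in \<open>auto simp: cone_slab_def\<close>)
  next
    case 3
    then obtain n s where ns: "y + (1 / real (Suc n)) *\<^sub>R P u + s *\<^sub>R \<omega> \<in> K"
      by (auto simp: tangent_cone_def shadow_iff)
    define \<delta>0 where "\<delta>0 = 1 / real (Suc n)"
    have \<delta>0: "\<delta>0 > 0" by (simp add: \<delta>0_def)
    \<comment> \<open>The height on the chord over \<open>y\<close> for which the segment to the point over \<open>y + \<delta>0 P u\<close> at
    height \<open>s\<close> passes through height \<open>?t\<close> over \<open>y + \<delta> P u\<close>.\<close>
    define t' where "t' \<delta> = (?t - \<delta> / \<delta>0 * s) / (1 - \<delta> / \<delta>0)" for \<delta>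
    have "(t' \<longlongrightarrow> (?t - 0 / \<delta>0 * s) / (1 - 0 / \<delta>0)) (at_right 0)"
      unfolding t'_def using \<delta>0 by (intro tendsto_intros) auto
    then have lim: "(t' \<longlongrightarrow> ?t) (at_right 0)" by simp
    have "\<forall>\<^sub>F \<delta> in at_right 0. a < t' \<delta>" "\<forall>\<^sub>F \<delta> in at_right 0. t' \<delta> < b"
      using order_tendstoD[OF lim] 3 by auto
    moreover have "\<forall>\<^sub>F \<delta> in at_right 0. \<delta> < \<delta>0" "\<forall>\<^sub>F \<delta> in at_right 0. (0::real) < \<delta>"
      using \<delta>0 by (auto intro: eventually_at_right_real eventually_at_right_less
        simp: eventually_at_right[OF \<delta>0])
    ultimately show ?thesis
    proof eventually_elim
      case (elim \<delta>)
      define \<mu> where "\<mu> = \<delta> / \<delta>0"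
      have \<mu>: "0 \<le> \<mu>" "\<mu> < 1" "\<mu> * \<delta>0 = \<delta>" using elim \<delta>0 by (auto simp: \<mu>_def)
      have t': "(1 - \<mu>) * t' \<delta> + \<mu> * s = ?t" using \<mu> unfolding t'_def \<mu>_def[symmetric] by simp
      have "y + t' \<delta> *\<^sub>R \<omega> \<in> K" using elim chord(2)[of "t' \<delta>"] by simp
      then have "(1 - \<mu>) *\<^sub>R (y + t' \<delta> *\<^sub>R \<omega>) + \<mu> *\<^sub>R (y + \<delta>0 *\<^sub>R P u + s *\<^sub>R \<omega>) \<in> K"
        using K(2) ns \<mu> unfolding \<delta>0_def by (intro convexD) auto
      also have "(1 - \<mu>) *\<^sub>R (y + t' \<delta> *\<^sub>R \<omega>) + \<mu> *\<^sub>R (y + \<delta>0 *\<^sub>R P u + s *\<^sub>R \<omega>)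
          = y + (\<mu> * \<delta>0) *\<^sub>R P u + ((1 - \<mu>) * t' \<delta> + \<mu> * s) *\<^sub>R \<omega>"
        by (simp add: algebra_simps)
      finally have "shrink \<delta> u \<in> K" unfolding t' \<mu>(3) shrink_def .
      then show ?case using 3 by (simp add: cone_slab_def)
    qed
  qed
qed

section \<open>Gaussian moments of the body and their limits\<close>

definition gauss_moment :: "(real \<Rightarrow> real) \<Rightarrow> real \<Rightarrow> real" where
  "gauss_moment w \<epsilon> = (LINT x|lborel. indicator K x * w (x \<bullet> \<omega>) * heat \<omega> \<epsilon> (y - x))"

definition cone_moment :: "(real \<Rightarrow> real) \<Rightarrow> real" where
  "cone_moment w = (LINT u|lborel. indicator cone_slab u * w (u \<bullet> \<omega>) * exp (- (norm (P u))\<^sup>2))"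

lemma heat_meas [measurable]: "heat \<omega> \<epsilon> \<in> borel_measurable borel"
  unfolding heat_def[abs_def] by measurable

text \<open>With \<open>\<delta> = 2 sqrt \<epsilon>\<close> the Jacobian \<open>\<delta>\<^sup>d\<close> and the normalisation \<open>(\<pi>/\<epsilon>)\<^sup>d\<^sup>/\<^sup>2\<close> combine to the
  constant \<open>(2 sqrt \<pi>)\<^sup>d\<close>, and the Gaussian loses its dependence on \<open>\<epsilon>\<close>.\<close>
lemma gauss_moment_rescale:
  assumes [measurable]: "w \<in> borel_measurable borel" and \<epsilon>: "\<epsilon> > 0"
  shows "gauss_moment w \<epsilon> = (2 * sqrt pi) ^ (DIM('a) - 1) *
    (LINT u|lborel. indicator K (shrink (2 * sqrt \<epsilon>) u) * w (u \<bullet> \<omega>) * exp (- (norm (P u))\<^sup>2))"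
proof -
  define \<delta> where "\<delta> = 2 * sqrt \<epsilon>"
  have \<delta>: "\<delta> > 0" "\<delta>\<^sup>2 = 4 * \<epsilon>" using \<epsilon> by (auto simp: \<delta>_def power_mult_distrib)
  have "heat \<omega> \<epsilon> (y - shrink \<delta> u) = sqrt (pi / \<epsilon>) ^ (DIM('a) - 1) * exp (- (norm (P u))\<^sup>2)" for u
  proof -
    have "P (y - shrink \<delta> u) = - (\<delta> *\<^sub>R P u)" by (simp add: shrink_def P.add P.diff P.neg P.scale)
    then have "(norm (P (y - shrink \<delta> u)))\<^sup>2 = 4 * \<epsilon> * (norm (P u))\<^sup>2"
      using \<delta> by (simp add: power_mult_distrib)
    then show ?thesis using \<epsilon> by (simp add: heat_def)
  qed
  note heat = this
  have "gauss_moment w \<epsilon> = \<delta> ^ (DIM('a) - 1) *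
      (LINT u|lborel. indicator K (shrink \<delta> u) * w (shrink \<delta> u \<bullet> \<omega>) * heat \<omega> \<epsilon> (y - shrink \<delta> u))"
    unfolding gauss_moment_def shrink_def
    by (rule lborel_integral_stretch_hyperplane[OF unit \<delta>(1)]) measurable
  also have "\<dots> = \<delta> ^ (DIM('a) - 1) * (LINT u|lborel. sqrt (pi / \<epsilon>) ^ (DIM('a) - 1) *
      (indicator K (shrink \<delta> u) * w (u \<bullet> \<omega>) * exp (- (norm (P u))\<^sup>2)))"
    unfolding heat shrink_inner by (simp add: mult_ac)
  also have "\<dots> = (\<delta> * sqrt (pi / \<epsilon>)) ^ (DIM('a) - 1) *
      (LINT u|lborel. indicator K (shrink \<delta> u) * w (u \<bullet> \<omega>) * exp (- (norm (P u))\<^sup>2))"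
    by (simp add: power_mult_distrib)
  also have "\<delta> * sqrt (pi / \<epsilon>) = 2 * sqrt pi"
    using \<epsilon> by (simp add: \<delta>_def real_sqrt_divide)
  finally show ?thesis by (simp add: \<delta>_def)
qed

text \<open>All sets in question lie in a slab of bounded height, where the Gaussian in the hyperplane
  directions is dominated by an integrable Gaussian on the whole space.\<close>
lemma slab_gaussian_bound:
  assumes "\<bar>u \<bullet> \<omega>\<bar> \<le> height_bound"
  shows "exp (- (norm (P u))\<^sup>2) \<le> exp (height_bound\<^sup>2) * exp (- (norm u)\<^sup>2)"
proof -
  have "(u \<bullet> \<omega>)\<^sup>2 \<le> height_bound\<^sup>2" using assms by (simp add: abs_le_square_iff[symmetric])
  then show ?thesis by (simp add: norm_hyperplane_proj[OF unit] flip: exp_add)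
qed

lemma weight_bounded:
  assumes "continuous_on UNIV w"
  obtains C where "C \<ge> 0" "\<And>t. \<bar>t\<bar> \<le> height_bound \<Longrightarrow> \<bar>w t\<bar> \<le> (C::real)"
proof -
  have "compact (w ` {-height_bound..height_bound})"
    using assms by (intro compact_continuous_image) (auto intro: continuous_on_subset)
  then obtain C where "\<forall>z\<in>w ` {-height_bound..height_bound}. norm z \<le> C" using compact_imp_bounded bounded_iff by metis
  then have "\<bar>w t\<bar> \<le> C" if "\<bar>t\<bar> \<le> height_bound" for t using that by (auto simp: abs_le_iff)
  then show ?thesis by (intro that[of "max C 0"]) (auto intro: max.coboundedI1)
qed

lemma tendsto_gauss_moment:
  assumes w: "continuous_on UNIV w"
  shows "(gauss_moment w \<longlongrightarrow> (2 * sqrt pi) ^ (DIM('a) - 1) * cone_moment w) (at_right 0)"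
proof -
  have [measurable]: "w \<in> borel_measurable borel" using w by (rule borel_measurable_continuous_onI)
  obtain C where C: "C \<ge> 0" "\<And>t. \<bar>t\<bar> \<le> height_bound \<Longrightarrow> \<bar>w t\<bar> \<le> C" using weight_bounded[OF w] by blast
  let ?I = "\<lambda>\<delta> u. indicator K (shrink \<delta> u) * w (u \<bullet> \<omega>) * exp (- (norm (P u))\<^sup>2)"
  have 1: "((\<lambda>\<delta>. LINT u|lborel. ?I \<delta> u) \<longlongrightarrow> cone_moment w) (at_right 0)"
  proof (rule tendsto_at_right_sequentially[of 0 1])
    fix S :: "nat \<Rightarrow> real"
    assume S: "\<And>n. 0 < S n" "S \<longlonglongrightarrow> 0"
    have Slim: "filterlim S (at_right 0) sequentially"
      using S by (intro tendsto_imp_filterlim_at_right) auto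
    show "(\<lambda>n. LINT u|lborel. ?I (S n) u) \<longlonglongrightarrow> cone_moment w"
      unfolding cone_moment_def
    proof (rule integral_dominated_convergence)
      show "integrable lborel (\<lambda>u::'a. C * (exp (height_bound\<^sup>2) * exp (- (norm u)\<^sup>2)))"
        by (intro integrable_mult_right integrable_exp_minus_norm_square)
      show "AE u in lborel. norm (?I (S n) u) \<le> C * (exp (height_bound\<^sup>2) * exp (- (norm u)\<^sup>2))" for n
      proof (rule AE_I2)
        fix u
        show "norm (?I (S n) u) \<le> C * (exp (height_bound\<^sup>2) * exp (- (norm u)\<^sup>2))"
        proof (cases "shrink (S n) u \<in> K")
          case True
          then have "\<bar>u \<bullet> \<omega>\<bar> \<le> height_bound" using height_bound[of "shrink (S n) u"] by simp
          then have "\<bar>w (u \<bullet> \<omega>)\<bar> * exp (- (norm (P u))\<^sup>2) \<le> C * (exp (height_bound\<^sup>2) * exp (- (norm u)\<^sup>2))"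
            using C slab_gaussian_bound by (intro mult_mono) auto
          then show ?thesis using True by (simp add: abs_mult)
        qed (use C in simp)
      qed
      have null: "AE u in lborel. u \<bullet> \<omega> \<noteq> c" for c
      proof -
        have "\<omega> \<noteq> 0" using unit by auto
        then have "negligible {u. \<omega> \<bullet> u = c}" by (intro negligible_hyperplane) simp
        moreover have "{u. \<omega> \<bullet> u = c} \<in> sets borel" by measurable
        ultimately have "{u. \<omega> \<bullet> u = c} \<in> null_sets lborel"
          by (simp add: negligible_iff_null_sets null_sets_completion_iff)
        then have "AE u in lborel. u \<notin> {u. \<omega> \<bullet> u = c}" by (rule AE_not_in)
        then show ?thesis by (simp add: inner_commute)
      qed
      show "AE u in lborel. (\<lambda>n. ?I (S n) u) \<longlonglongrightarrow> indicator cone_slab u * w (u \<bullet> \<omega>) * exp (- (norm (P u))\<^sup>2)"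
        using null[of a] null[of b]
      proof eventually_elim
        case (elim u)
        have "\<forall>\<^sub>F n in sequentially. shrink (S n) u \<in> K \<longleftrightarrow> u \<in> cone_slab"
          using eventually_shrink_in_K_iff[OF elim] Slim by (rule eventually_compose_filterlim)
        then have "\<forall>\<^sub>F n in sequentially. ?I (S n) u = indicator cone_slab u * w (u \<bullet> \<omega>) * exp (- (norm (P u))\<^sup>2)"
          by eventually_elim (simp add: indicator_def)
        then show ?case by (rule tendsto_eventually)
      qed
    qed measurable
  qed simp
  have "filterlim (\<lambda>\<epsilon>. 2 * sqrt \<epsilon>) (at_right 0) (at_right (0::real))"
  proof (rule tendsto_imp_filterlim_at_right)
    have "((\<lambda>\<epsilon>. 2 * sqrt \<epsilon>) \<longlongrightarrow> 2 * sqrt 0) (at_right (0::real))" by (intro tendsto_intros)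
    then show "((\<lambda>\<epsilon>. 2 * sqrt \<epsilon>) \<longlongrightarrow> 0) (at_right (0::real))" by simp
    show "\<forall>\<^sub>F \<epsilon> in at_right 0. 2 * sqrt \<epsilon> > (0::real)"
      using eventually_at_right_less[of "0::real"] by eventually_elim simp
  qed
  from filterlim_compose[OF 1 this]
  have "((\<lambda>\<epsilon>. (2 * sqrt pi) ^ (DIM('a) - 1) * (LINT u|lborel. ?I (2 * sqrt \<epsilon>) u))
      \<longlongrightarrow> (2 * sqrt pi) ^ (DIM('a) - 1) * cone_moment w) (at_right 0)"
    by (rule tendsto_mult_left)
  moreover have "\<forall>\<^sub>F \<epsilon> in at_right 0. (2 * sqrt pi) ^ (DIM('a) - 1) * (LINT u|lborel. ?I (2 * sqrt \<epsilon>) u) = gauss_moment w \<epsilon>"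
    using eventually_at_right_less[of "0::real"] by eventually_elim (simp add: gauss_moment_rescale)
  ultimately show ?thesis by (rule Lim_transform_eventually)
qed

lemma cone_moment_integrable:
  assumes w: "continuous_on UNIV w"
  shows "integrable lborel (\<lambda>u. indicator cone_slab u * w (u \<bullet> \<omega>) * exp (- (norm (P u))\<^sup>2))"
proof -
  have [measurable]: "w \<in> borel_measurable borel" using w by (rule borel_measurable_continuous_onI)
  obtain C where C: "C \<ge> 0" "\<And>t. \<bar>t\<bar> \<le> height_bound \<Longrightarrow> \<bar>w t\<bar> \<le> C" using weight_bounded[OF w] by blast
  show ?thesis
  proof (rule Bochner_Integration.integrable_bound)
    show "integrable lborel (\<lambda>u::'a. C * (exp (height_bound\<^sup>2) * exp (- (norm u)\<^sup>2)))"
      by (intro integrable_mult_right integrable_exp_minus_norm_square)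
    show "(\<lambda>u. indicator cone_slab u * w (u \<bullet> \<omega>) * exp (- (norm (P u))\<^sup>2)) \<in> borel_measurable lborel"
      by measurable
    show "AE u in lborel. norm (indicator cone_slab u * w (u \<bullet> \<omega>) * exp (- (norm (P u))\<^sup>2))
        \<le> norm (C * (exp (height_bound\<^sup>2) * exp (- (norm u)\<^sup>2)))"
    proof (rule AE_I2)
      fix u
      show "norm (indicator cone_slab u * w (u \<bullet> \<omega>) * exp (- (norm (P u))\<^sup>2))
        \<le> norm (C * (exp (height_bound\<^sup>2) * exp (- (norm u)\<^sup>2)))"
      proof (cases "u \<in> cone_slab")
        case True
        then have "y + (u \<bullet> \<omega>) *\<^sub>R \<omega> \<in> K" by (simp add: cone_slab_def chord)
        from height_bound[OF this] have "\<bar>u \<bullet> \<omega>\<bar> \<le> height_bound" by (simp add: inner_simps)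
        then have "\<bar>w (u \<bullet> \<omega>)\<bar> * exp (- (norm (P u))\<^sup>2) \<le> C * (exp (height_bound\<^sup>2) * exp (- (norm u)\<^sup>2))"
          using C slab_gaussian_bound by (intro mult_mono) auto
        then show ?thesis using True C by (simp add: abs_mult)
      qed simp
    qed
  qed
qed

text \<open>The reflection \<open>\<rho>\<close> of heights in the midpoint of the chord preserves Lebesgue measure, the
  Gaussian weight and the region of integration, and changes the sign of the height measured
  from the midpoint.\<close>
lemma cone_moment_first: "cone_moment (\<lambda>t. t) = chord_mid \<omega> K y * cone_moment (\<lambda>_. 1)"
proof -
  define m where "m = chord_mid \<omega> K y"
  define \<rho> where "\<rho> u = (2 * m) *\<^sub>R \<omega> + (u - (2 * (u \<bullet> \<omega>)) *\<^sub>R \<omega>)" for u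
  define h where "h u = indicator cone_slab u * (u \<bullet> \<omega> - m) * exp (- (norm (P u))\<^sup>2)" for u
  have [measurable]: "\<rho> \<in> borel_measurable borel" unfolding \<rho>_def[abs_def] by measurable
  have [measurable]: "h \<in> borel_measurable borel" unfolding h_def[abs_def] by measurable
  have "distr lborel borel \<rho> = distr (distr lborel borel (\<lambda>u. u - (2 * (u \<bullet> \<omega>)) *\<^sub>R \<omega>)) borel ((+) ((2 * m) *\<^sub>R \<omega>))"
    by (subst distr_distr) (auto simp: \<rho>_def[abs_def] o_def)
  also have "\<dots> = lborel"
    by (simp add: orthogonal_transformation_distr_lborel orthogonal_transformation_reflection unit lborel_distr_plus)
  finally have \<rho>: "distr lborel borel \<rho> = lborel" .
  have P\<rho>: "P (\<rho> u) = P u" for u by (simp add: \<rho>_def P.add P.diff P.scale)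
  have m: "2 * m = a + b" by (simp add: m_def chord_mid_def)
  have \<rho>\<omega>: "\<rho> u \<bullet> \<omega> = 2 * m - u \<bullet> \<omega>" for u by (simp add: \<rho>_def inner_simps)
  have "\<rho> u \<in> cone_slab \<longleftrightarrow> u \<in> cone_slab" for u
    unfolding cone_slab_def tangent_cone_def mem_Collect_eq P\<rho> \<rho>\<omega> m by auto
  then have h\<rho>: "h (\<rho> u) = - h u" for u
    by (simp add: h_def P\<rho> \<rho>\<omega> indicator_def algebra_simps)
  have "(LINT u|lborel. h u) = (LINT u|lborel. h (\<rho> u))"
    by (subst \<rho>[symmetric]) (simp add: integral_distr)
  then have "(LINT u|lborel. h u) = 0" by (simp add: h\<rho>)
  moreover have "(LINT u|lborel. h u) = cone_moment (\<lambda>t. t) - m * cone_moment (\<lambda>_. 1)"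
  proof -
    have "h u = indicator cone_slab u * (u \<bullet> \<omega>) * exp (- (norm (P u))\<^sup>2)
        - m * (indicator cone_slab u * 1 * exp (- (norm (P u))\<^sup>2))" for u
      by (simp add: h_def algebra_simps)
    then show ?thesis
      using cone_moment_integrable[of "\<lambda>t. t"] cone_moment_integrable[of "\<lambda>_. 1"]
      by (simp add: cone_moment_def)
  qed
  ultimately show ?thesis by (simp add: m_def)
qed

text \<open>The shadow of a ball inside \<open>K\<close> yields an open set of directions in the tangent cone.\<close>
lemma cone_moment_pos:
  assumes ab: "a < b"
  shows "cone_moment (\<lambda>_. 1) > 0"
proof -
  obtain z0 r where z0: "r > 0" "ball z0 r \<subseteq> K"
    using K(3) by (metis all_not_in_conv mem_interior)
  define U where "U = {u. dist (P u) (P z0 - y) < r \<and> a < u \<bullet> \<omega> \<and> u \<bullet> \<omega> < b}"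
  have "open U"
    unfolding U_def hyperplane_proj_def
    by (intro open_Collect_conj open_Collect_less continuous_intros)
  moreover have "P z0 - y + ((a + b) / 2) *\<^sub>R \<omega> \<in> U"
    using z0 ab by (simp add: U_def P.add P.diff P.scale inner_simps)
  ultimately have U: "\<not> negligible U" using open_not_negligible by blast
  have US: "U \<subseteq> cone_slab"
  proof
    fix u assume u: "u \<in> U"
    let ?z = "z0 + (y + P u - P z0)"
    have "?z \<in> ball z0 r" using u by (simp add: U_def dist_norm norm_minus_commute algebra_simps)
    then have "P ?z \<in> shadow \<omega> K" using z0 by (auto simp: shadow_def)
    then have "y + P u \<in> shadow \<omega> K" by (simp add: P.add P.diff)
    then have "u \<in> tangent_cone" unfolding tangent_cone_def by (intro CollectI exI[of _ 0]) simp
    then show "u \<in> cone_slab" using u by (simp add: cone_slab_def U_def)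
  qed
  let ?f = "\<lambda>u. indicator cone_slab u * 1 * exp (- (norm (P u))\<^sup>2) :: real"
  have int: "integrable lborel ?f" by (rule cone_moment_integrable) simp
  have nonneg: "AE u in lborel. 0 \<le> ?f u" by simp
  have "cone_moment (\<lambda>_. 1) \<ge> 0" unfolding cone_moment_def by (intro integral_nonneg_AE nonneg)
  moreover have "cone_moment (\<lambda>_. 1) \<noteq> 0"
  proof
    assume "cone_moment (\<lambda>_. 1) = 0"
    then have "AE u in lborel. ?f u = 0"
      unfolding cone_moment_def using integral_nonneg_eq_0_iff_AE[OF int nonneg] by simp
    then have "AE u in lborel. u \<notin> U" by (rule eventually_mono) (use US in \<open>auto simp: indicator_def split: if_splits\<close>)
    then have "AE u in lebesgue. u \<notin> U" by (rule AE_completion)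
    then have "negligible U" by (auto simp: negligible_iff_null_sets AE_iff_null_sets eventually_ae_filter
        intro: null_sets_completion_subset)
    then show False using U by simp
  qed
  ultimately show ?thesis by simp
qed

lemma heat_pos: "\<epsilon> > 0 \<Longrightarrow> heat \<omega> \<epsilon> v > 0"
  by (simp add: heat_def)

lemma gauss_moment_integrable:
  assumes w: "continuous_on UNIV w" and \<epsilon>: "\<epsilon> > 0"
  shows "integrable lborel (\<lambda>x. indicator K x * w (x \<bullet> \<omega>) * heat \<omega> \<epsilon> (y - x))"
proof -
  have "integrable lborel (\<lambda>x. indicator K x *\<^sub>R (w (x \<bullet> \<omega>) * heat \<omega> \<epsilon> (y - x)))"
    unfolding heat_def hyperplane_proj_def using \<epsilon>
    by (intro borel_integrable_compact[OF K(1)] continuous_intros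
        continuous_on_compose2[OF w]) auto
  then show ?thesis by (simp add: mult.assoc)
qed

section \<open>Degenerate chords\<close>

lemma gauss_moment_one_lower_bound:
  assumes \<epsilon>: "\<epsilon> > 0" and U: "open U" "U \<subseteq> K" "\<And>x. x \<in> U \<Longrightarrow> norm (P (y - x)) \<le> \<rho>"
  shows "measure lborel U * (sqrt (pi / \<epsilon>) ^ (DIM('a) - 1) * exp (- \<rho>\<^sup>2 / (4 * \<epsilon>))) \<le> gauss_moment (\<lambda>_. 1) \<epsilon>"
proof -
  let ?c = "sqrt (pi / \<epsilon>) ^ (DIM('a) - 1) * exp (- \<rho>\<^sup>2 / (4 * \<epsilon>))"
  have [measurable]: "U \<in> sets borel" using U by simp
  have "emeasure lborel U < \<infinity>"
    using compact_imp_bounded[OF K(1)] U(2) bounded_subset emeasure_bounded_finite by blast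
  then have Uint: "integrable lborel (indicator U :: 'a \<Rightarrow> real)"
    by (simp add: integrable_indicator_iff)
  have "(LINT x|lborel. ?c * indicator U x) \<le> gauss_moment (\<lambda>_. 1) \<epsilon>"
    unfolding gauss_moment_def
  proof (rule integral_mono)
    show "integrable lborel (\<lambda>x. ?c * indicator U x)" using Uint by (rule integrable_mult_right)
    show "integrable lborel (\<lambda>x. indicator K x * 1 * heat \<omega> \<epsilon> (y - x))"
      by (rule gauss_moment_integrable) (use \<epsilon> in auto)
    fix x
    show "?c * indicator U x \<le> indicator K x * 1 * heat \<omega> \<epsilon> (y - x)"
    proof (cases "x \<in> U")
      case True
      then have "(norm (P (y - x)))\<^sup>2 \<le> \<rho>\<^sup>2" using U(3) by (intro power_mono) auto
      then have "?c \<le> heat \<omega> \<epsilon> (y - x)"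
        unfolding heat_def using \<epsilon> by (intro mult_left_mono) (auto simp: divide_right_mono)
      then show ?thesis using True U(2) by auto
    next
      case False
      then show ?thesis using heat_pos[OF \<epsilon>, of "y - x"] by (auto simp: indicator_def)
    qed
  qed
  then show ?thesis using Uint by (simp add: mult.commute)
qed

text \<open>The endpoint of the chord is a limit of interior points of \<open>K\<close>.\<close>
lemma nonempty_interior_near_chord:
  assumes "\<rho> > 0"
  obtains U where "open U" "U \<subseteq> K" "measure lborel U > 0" "\<And>x. x \<in> U \<Longrightarrow> norm (P (y - x)) \<le> \<rho>"
proof -
  define V where "V = {x. norm (P (y - x)) < \<rho>}"
  have V: "open V"
    unfolding V_def hyperplane_proj_def by (intro open_Collect_less continuous_intros)
  have "y + a *\<^sub>R \<omega> \<in> K" using chord by simp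
  then have "y + a *\<^sub>R \<omega> \<in> closure (interior K)"
    using convex_closure_interior[OF K(2,3)] closure_subset by auto
  moreover have "y + a *\<^sub>R \<omega> \<in> V" using assms by (simp add: V_def P.diff P.add P.scale)
  ultimately have ne: "V \<inter> interior K \<noteq> {}" using V open_Int_closure_eq_empty[OF V] by blast
  let ?U = "V \<inter> interior K"
  have U: "open ?U" "?U \<subseteq> K" using V interior_subset by auto
  then have bdd: "bounded ?U" using compact_imp_bounded[OF K(1)] bounded_subset by blast
  have "?U \<in> lmeasurable" using U bdd by (intro lmeasurable_open)
  moreover have "\<not> negligible ?U" using open_not_negligible[OF U(1) ne] .
  ultimately have "measure lebesgue ?U \<noteq> 0" by (simp add: negligible_iff_measure)
  then have "measure lborel ?U > 0" using U by (simp add: measure_completion less_le)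
  then show ?thesis using U by (intro that[of ?U]) (auto simp: V_def)
qed

lemma gauss_moment_one_pos: "\<epsilon> > 0 \<Longrightarrow> gauss_moment (\<lambda>_. 1) \<epsilon> > 0"
proof -
  assume \<epsilon>: "\<epsilon> > 0"
  obtain U where U: "open U" "U \<subseteq> K" "measure lborel U > 0" "\<And>x. x \<in> U \<Longrightarrow> norm (P (y - x)) \<le> 1"
    using nonempty_interior_near_chord[of 1] by auto
  have "0 < measure lborel U * (sqrt (pi / \<epsilon>) ^ (DIM('a) - 1) * exp (- 1\<^sup>2 / (4 * \<epsilon>)))"
    using U(3) \<epsilon> by (intro mult_pos_pos) auto
  also have "\<dots> \<le> gauss_moment (\<lambda>_. 1) \<epsilon>" by (rule gauss_moment_one_lower_bound[OF \<epsilon> U(1,2,4)])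
  finally show ?thesis .
qed

text \<open>Points of \<open>K\<close> at distance at least \<open>\<rho>\<close> from the line through \<open>y\<close> carry weight at most of order
  \<open>exp (- \<rho>\<^sup>2 / (4 \<epsilon>))\<close>, whereas an open part of \<open>K\<close> within distance \<open>\<rho> / 2\<close> contributes at least
  a constant times \<open>exp (- \<rho>\<^sup>2 / (16 \<epsilon>))\<close> to the total, with the same power of \<open>\<epsilon>\<close> in front.
  So the far points contribute \<open>O(exp (- 3 \<rho>\<^sup>2 / (16 \<epsilon>)))\<close> to the average height, and the near
  ones have height within \<open>\<eta>'\<close> of \<open>a\<close>.\<close>
lemma gauss_moment_ratio_degenerate:
  assumes ab: "a = b"
  shows "((\<lambda>\<epsilon>. gauss_moment (\<lambda>t. t) \<epsilon> / gauss_moment (\<lambda>_. 1) \<epsilon>) \<longlongrightarrow> a) (at_right 0)"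
proof (rule tendstoI)
  fix \<eta> :: real assume "\<eta> > 0"
  define \<eta>' where "\<eta>' = \<eta> / 2"
  have \<eta>': "\<eta>' > 0" using \<open>\<eta> > 0\<close> by (simp add: \<eta>'_def)
  \<comment> \<open>If some points of \<open>K\<close> have height at least \<open>\<eta>'\<close> away from \<open>a\<close>, their least distance from the
  line is attained; it is positive since \<open>K\<close> meets that line only at height \<open>a\<close>.\<close>
  obtain \<rho> where \<rho>: "\<rho> > 0" "\<And>x. x \<in> K \<Longrightarrow> norm (P (y - x)) < \<rho> \<Longrightarrow> \<bar>x \<bullet> \<omega> - a\<bar> < \<eta>'"
  proof (cases "K \<inter> {x. \<eta>' \<le> \<bar>x \<bullet> \<omega> - a\<bar>} = {}")
    case True
    then show ?thesis by (intro that[of 1]) force+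
  next
    case False
    have "closed {x. \<eta>' \<le> \<bar>x \<bullet> \<omega> - a\<bar>}" by (intro closed_Collect_le continuous_intros)
    then have cpt: "compact (K \<inter> {x. \<eta>' \<le> \<bar>x \<bullet> \<omega> - a\<bar>})" using K(1) by blast
    have cont: "continuous_on (K \<inter> {x. \<eta>' \<le> \<bar>x \<bullet> \<omega> - a\<bar>}) (\<lambda>x. norm (P (y - x)))"
      unfolding hyperplane_proj_def by (intro continuous_intros)
    obtain x0 where x0: "x0 \<in> K" "\<eta>' \<le> \<bar>x0 \<bullet> \<omega> - a\<bar>"
      and min: "\<And>x. x \<in> K \<Longrightarrow> \<eta>' \<le> \<bar>x \<bullet> \<omega> - a\<bar> \<Longrightarrow> norm (P (y - x0)) \<le> norm (P (y - x))"
      using continuous_attains_inf[OF cpt False cont] by auto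
    have "norm (P (y - x0)) > 0"
    proof (rule ccontr)
      assume "\<not> norm (P (y - x0)) > 0"
      then have "y = P x0" by (simp add: P.diff)
      then have "x0 = y + (x0 \<bullet> \<omega>) *\<^sub>R \<omega>" by (simp add: hyperplane_proj_def)
      then have "x0 \<bullet> \<omega> = a" using x0(1) chord(2)[of "x0 \<bullet> \<omega>"] ab by simp
      then show False using x0(2) \<eta>' by simp
    qed
    then show ?thesis using min by (intro that[of "norm (P (y - x0))"]) (auto simp: not_less[symmetric])
  qed
  obtain U where U: "open U" "U \<subseteq> K" "measure lborel U > 0"
    "\<And>x. x \<in> U \<Longrightarrow> norm (P (y - x)) \<le> \<rho> / 2"
    using nonempty_interior_near_chord[of "\<rho> / 2"] \<rho>(1) by auto
  define C where "C = (height_bound + \<bar>a\<bar>) * measure lborel K / measure lborel U"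
  have height_bound_nonneg: "height_bound \<ge> 0"
  proof -
    have "\<bar>(y + a *\<^sub>R \<omega>) \<bullet> \<omega>\<bar> \<le> height_bound" using chord by (intro height_bound) auto
    then show ?thesis by linarith
  qed
  have K_fin: "integrable lborel (indicator K :: 'a \<Rightarrow> real)"
    using emeasure_bounded_finite[OF compact_imp_bounded[OF K(1)]]
    by (subst integrable_indicator_iff) (auto simp: less_top)
  have bound: "\<bar>gauss_moment (\<lambda>t. t) \<epsilon> / gauss_moment (\<lambda>_. 1) \<epsilon> - a\<bar> \<le> \<eta>' + C * exp (- (3 * \<rho>\<^sup>2 / 16) / \<epsilon>)"
    if \<epsilon>: "\<epsilon> > 0" for \<epsilon>
  proof -
    define s where "s = sqrt (pi / \<epsilon>) ^ (DIM('a) - 1)"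
    have s: "s > 0" using \<epsilon> by (simp add: s_def)
    define q where "q = s * exp (- \<rho>\<^sup>2 / (4 * \<epsilon>))"
    have q: "q > 0" using s by (simp add: q_def)
    have M: "gauss_moment (\<lambda>_. 1) \<epsilon> > 0" using \<epsilon> by (rule gauss_moment_one_pos)
    have int: "integrable lborel (\<lambda>x. indicator K x * w (x \<bullet> \<omega>) * heat \<omega> \<epsilon> (y - x))"
      if "continuous_on UNIV w" for w using that \<epsilon> by (rule gauss_moment_integrable)
    note int1 = int[of "\<lambda>_. 1", simplified] and intt = int[of "\<lambda>t. t", simplified]
    have "\<bar>gauss_moment (\<lambda>t. t) \<epsilon> - a * gauss_moment (\<lambda>_. 1) \<epsilon>\<bar>
        = \<bar>LINT x|lborel. indicator K x * (x \<bullet> \<omega>) * heat \<omega> \<epsilon> (y - x) - a * (indicator K x * heat \<omega> \<epsilon> (y - x))\<bar>"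
      using int1 intt by (simp add: gauss_moment_def)
    also have "\<dots> \<le> (LINT x|lborel. \<eta>' * (indicator K x * heat \<omega> \<epsilon> (y - x)) + (height_bound + \<bar>a\<bar>) * q * indicator K x)"
    proof (subst real_norm_def[symmetric], rule Bochner_Integration.integral_norm_bound_integral)
      show "integrable lborel (\<lambda>x. indicator K x * (x \<bullet> \<omega>) * heat \<omega> \<epsilon> (y - x) - a * (indicator K x * heat \<omega> \<epsilon> (y - x)))"
        using int1 intt by simp
      show "integrable lborel (\<lambda>x. \<eta>' * (indicator K x * heat \<omega> \<epsilon> (y - x)) + (height_bound + \<bar>a\<bar>) * q * indicator K x)"
        using int1 K_fin by (intro Bochner_Integration.integrable_add integrable_mult_right)
      fix x
      show "norm (indicator K x * (x \<bullet> \<omega>) * heat \<omega> \<epsilon> (y - x) - a * (indicator K x * heat \<omega> \<epsilon> (y - x)))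
          \<le> \<eta>' * (indicator K x * heat \<omega> \<epsilon> (y - x)) + (height_bound + \<bar>a\<bar>) * q * indicator K x"
      proof (cases "x \<in> K")
        case True
        have h: "heat \<omega> \<epsilon> (y - x) > 0" using \<epsilon> by (rule heat_pos)
        have "\<bar>x \<bullet> \<omega> - a\<bar> * heat \<omega> \<epsilon> (y - x) \<le> \<eta>' * heat \<omega> \<epsilon> (y - x) + (height_bound + \<bar>a\<bar>) * q"
        proof (cases "norm (P (y - x)) < \<rho>")
          case near: True
          have "\<bar>x \<bullet> \<omega> - a\<bar> * heat \<omega> \<epsilon> (y - x) \<le> \<eta>' * heat \<omega> \<epsilon> (y - x)"
            using \<rho>(2)[OF True near] h by (intro mult_right_mono) auto
          moreover have "0 \<le> (height_bound + \<bar>a\<bar>) * q" using height_bound_nonneg q by simp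
          ultimately show ?thesis by linarith
        next
          case far: False
          have "heat \<omega> \<epsilon> (y - x) \<le> q"
          proof -
            have "\<rho>\<^sup>2 \<le> (norm (P (y - x)))\<^sup>2" using far \<rho>(1) by (intro power_mono) auto
            then show ?thesis
              unfolding heat_def q_def s_def[symmetric] using \<epsilon> s
              by (intro mult_left_mono) (auto simp: divide_right_mono)
          qed
          moreover have "\<bar>x \<bullet> \<omega> - a\<bar> \<le> height_bound + \<bar>a\<bar>" using height_bound[OF True] by linarith
          ultimately have "\<bar>x \<bullet> \<omega> - a\<bar> * heat \<omega> \<epsilon> (y - x) \<le> (height_bound + \<bar>a\<bar>) * q"
            using h height_bound_nonneg by (intro mult_mono) auto
          moreover have "0 \<le> \<eta>' * heat \<omega> \<epsilon> (y - x)" using h \<eta>' by simp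
          ultimately show ?thesis by linarith
        qed
        moreover have "norm ((x \<bullet> \<omega>) * heat \<omega> \<epsilon> (y - x) - a * heat \<omega> \<epsilon> (y - x)) = \<bar>x \<bullet> \<omega> - a\<bar> * heat \<omega> \<epsilon> (y - x)"
          using h by (simp add: left_diff_distrib[symmetric] abs_mult)
        ultimately show ?thesis using True by simp
      qed simp
    qed
    also have "\<dots> = \<eta>' * gauss_moment (\<lambda>_. 1) \<epsilon> + (height_bound + \<bar>a\<bar>) * q * measure lborel K"
      using int1 K_fin by (simp add: gauss_moment_def)
    also have "(height_bound + \<bar>a\<bar>) * q * measure lborel K
        = C * exp (- (3 * \<rho>\<^sup>2 / 16) / \<epsilon>) * (measure lborel U * (s * exp (- (\<rho> / 2)\<^sup>2 / (4 * \<epsilon>))))"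
    proof -
      have "exp (- \<rho>\<^sup>2 / (4 * \<epsilon>)) = exp (- (3 * \<rho>\<^sup>2 / 16) / \<epsilon>) * exp (- (\<rho> / 2)\<^sup>2 / (4 * \<epsilon>))"
        using \<epsilon> by (simp add: field_simps flip: exp_add)
      then show ?thesis using U(3) by (simp add: C_def q_def)
    qed
    also have "\<dots> \<le> C * exp (- (3 * \<rho>\<^sup>2 / 16) / \<epsilon>) * gauss_moment (\<lambda>_. 1) \<epsilon>"
      using gauss_moment_one_lower_bound[OF \<epsilon> U(1,2,4)] height_bound_nonneg unfolding s_def[symmetric]
      by (intro mult_left_mono) (auto simp: C_def)
    finally have "\<bar>gauss_moment (\<lambda>t. t) \<epsilon> - a * gauss_moment (\<lambda>_. 1) \<epsilon>\<bar>
        \<le> (\<eta>' + C * exp (- (3 * \<rho>\<^sup>2 / 16) / \<epsilon>)) * gauss_moment (\<lambda>_. 1) \<epsilon>"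
      by (simp add: algebra_simps)
    moreover have "gauss_moment (\<lambda>t. t) \<epsilon> / gauss_moment (\<lambda>_. 1) \<epsilon> - a = (gauss_moment (\<lambda>t. t) \<epsilon> - a * gauss_moment (\<lambda>_. 1) \<epsilon>) / gauss_moment (\<lambda>_. 1) \<epsilon>"
      using M by (simp add: diff_divide_distrib)
    ultimately show ?thesis using M by (simp add: pos_divide_le_eq)
  qed
  have "((\<lambda>\<epsilon>. \<eta>' + C * exp (- (3 * \<rho>\<^sup>2 / 16) / \<epsilon>)) \<longlongrightarrow> \<eta>' + C * 0) (at_right 0)"
    using \<rho>(1) by (intro tendsto_intros tendsto_exp_minus_divide_at_right_0) simp
  moreover have "\<eta>' + C * 0 < \<eta>" using \<open>\<eta> > 0\<close> by (simp add: \<eta>'_def)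
  ultimately have "\<forall>\<^sub>F \<epsilon> in at_right 0. \<eta>' + C * exp (- (3 * \<rho>\<^sup>2 / 16) / \<epsilon>) < \<eta>"
    by (rule order_tendstoD(2))
  then show "\<forall>\<^sub>F \<epsilon> in at_right 0. dist (gauss_moment (\<lambda>t. t) \<epsilon> / gauss_moment (\<lambda>_. 1) \<epsilon>) a < \<eta>"
    using eventually_at_right_less[of "0::real"]
    by eventually_elim (use bound in \<open>force simp: dist_real_def\<close>)
qed

section \<open>The inversion integrals\<close>

lemma integrable_indicator_moment: "integrable lborel (\<lambda>x. indicator K x * w (x \<bullet> \<omega>))"
  if w: "continuous_on UNIV w" for w :: "real \<Rightarrow> real"
proof -
  have "integrable lborel (\<lambda>x. indicator K x *\<^sub>R w (x \<bullet> \<omega>))"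
    by (intro borel_integrable_compact[OF K(1)] continuous_on_compose2[OF w] continuous_intros) auto
  then show ?thesis by simp
qed

lemma gauss_mean_fourier_indicator:
  assumes \<epsilon>: "\<epsilon> > 0"
  shows "integrable (subspace_lborel (hyperplane \<omega>)) (gauss_integrand (fourier_indicator K) y \<epsilon>)"
    and "gauss_mean \<omega> (fourier_indicator K) y \<epsilon> = complex_of_real (gauss_moment (\<lambda>_. 1) \<epsilon>)"
proof -
  have g: "integrable lborel (indicator K :: 'a \<Rightarrow> complex)"
  proof -
    have "integrable lborel (\<lambda>x. complex_of_real (indicator K x * 1))"
      by (intro integrable_of_real integrable_indicator_moment) simp
    then show ?thesis by (simp add: of_real_indicator)
  qed
  show "integrable (subspace_lborel (hyperplane \<omega>)) (gauss_integrand (fourier_indicator K) y \<epsilon>)"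
    unfolding fourier_indicator_eq_fourier by (rule gauss_mean_fourier(1)[OF unit g \<epsilon>])
  show "gauss_mean \<omega> (fourier_indicator K) y \<epsilon> = complex_of_real (gauss_moment (\<lambda>_. 1) \<epsilon>)"
    unfolding fourier_indicator_eq_fourier gauss_mean_fourier(2)[OF unit g \<epsilon>] gauss_moment_def
    by (simp add: of_real_indicator flip: integral_complex_of_real)
qed

lemma gauss_mean_dir_deriv_fourier_indicator:
  assumes \<epsilon>: "\<epsilon> > 0"
  shows "integrable (subspace_lborel (hyperplane \<omega>))
      (gauss_integrand (dir_deriv \<omega> (fourier_indicator K)) y \<epsilon>)"
    and "gauss_mean \<omega> (dir_deriv \<omega> (fourier_indicator K)) y \<epsilon> = - \<i> * complex_of_real (gauss_moment (\<lambda>t. t) \<epsilon>)"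
proof -
  have g: "integrable lborel (\<lambda>x. - \<i> * complex_of_real (indicator K x * (x \<bullet> \<omega>)))"
    by (intro integrable_mult_right integrable_of_real integrable_indicator_moment) simp
  show "integrable (subspace_lborel (hyperplane \<omega>))
      (gauss_integrand (dir_deriv \<omega> (fourier_indicator K)) y \<epsilon>)"
    unfolding dir_deriv_fourier_indicator[OF K(1)] by (rule gauss_mean_fourier(1)[OF unit g \<epsilon>])
  show "gauss_mean \<omega> (dir_deriv \<omega> (fourier_indicator K)) y \<epsilon> = - \<i> * complex_of_real (gauss_moment (\<lambda>t. t) \<epsilon>)"
    unfolding dir_deriv_fourier_indicator[OF K(1)] gauss_mean_fourier(2)[OF unit g \<epsilon>] gauss_moment_def
    by (simp add: mult.assoc flip: integral_complex_of_real)
qed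

lemma tendsto_gauss_mean:
  defines "L w \<equiv> (2 * sqrt pi) ^ (DIM('a) - 1) * cone_moment w"
  shows "(gauss_mean \<omega> (fourier_indicator K) y \<longlongrightarrow> complex_of_real (L (\<lambda>_. 1))) (at_right 0)"
    and "(gauss_mean \<omega> (dir_deriv \<omega> (fourier_indicator K)) y \<longlongrightarrow> - \<i> * complex_of_real (L (\<lambda>t. t))) (at_right 0)"
proof -
  have "((\<lambda>\<epsilon>. complex_of_real (gauss_moment (\<lambda>_. 1) \<epsilon>)) \<longlongrightarrow> complex_of_real (L (\<lambda>_. 1))) (at_right 0)"
    unfolding L_def by (intro tendsto_of_real tendsto_gauss_moment) simp
  moreover have "\<forall>\<^sub>F \<epsilon> in at_right 0. complex_of_real (gauss_moment (\<lambda>_. 1) \<epsilon>) = gauss_mean \<omega> (fourier_indicator K) y \<epsilon>"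
    using eventually_at_right_less[of "0::real"]
    by eventually_elim (simp add: gauss_mean_fourier_indicator)
  ultimately show "(gauss_mean \<omega> (fourier_indicator K) y \<longlongrightarrow> complex_of_real (L (\<lambda>_. 1))) (at_right 0)"
    by (rule Lim_transform_eventually)
  have "((\<lambda>\<epsilon>. - \<i> * complex_of_real (gauss_moment (\<lambda>t. t) \<epsilon>)) \<longlongrightarrow> - \<i> * complex_of_real (L (\<lambda>t. t))) (at_right 0)"
    unfolding L_def by (intro tendsto_mult_left tendsto_of_real tendsto_gauss_moment) simp
  moreover have "\<forall>\<^sub>F \<epsilon> in at_right 0. - \<i> * complex_of_real (gauss_moment (\<lambda>t. t) \<epsilon>)
      = gauss_mean \<omega> (dir_deriv \<omega> (fourier_indicator K)) y \<epsilon>"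
    using eventually_at_right_less[of "0::real"]
    by eventually_elim (simp add: gauss_mean_dir_deriv_fourier_indicator)
  ultimately show "(gauss_mean \<omega> (dir_deriv \<omega> (fourier_indicator K)) y \<longlongrightarrow> - \<i> * complex_of_real (L (\<lambda>t. t))) (at_right 0)"
    by (rule Lim_transform_eventually)
qed

text \<open>The last identity is stated without a division, so that it also covers points at which both
  inversion integrals vanish.\<close>
lemma inversion_integrals:
  shows "inversion_integrable \<omega> (fourier_indicator K) y"
    and "inversion_integrable \<omega> (dir_deriv \<omega> (fourier_indicator K)) y"
    and "inversion_integral \<omega> (fourier_indicator K) y
      = complex_of_real ((2 * sqrt pi) ^ (DIM('a) - 1) * cone_moment (\<lambda>_. 1))"
    and "\<i> * inversion_integral \<omega> (dir_deriv \<omega> (fourier_indicator K)) y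
      = complex_of_real (chord_mid \<omega> K y) * inversion_integral \<omega> (fourier_indicator K) y"
proof -
  show "inversion_integrable \<omega> (fourier_indicator K) y"
    unfolding inversion_integrable_def
    using tendsto_gauss_mean(1) gauss_mean_fourier_indicator(1) by blast
  show "inversion_integrable \<omega> (dir_deriv \<omega> (fourier_indicator K)) y"
    unfolding inversion_integrable_def
    using tendsto_gauss_mean(2) gauss_mean_dir_deriv_fourier_indicator(1) by blast
  show 1: "inversion_integral \<omega> (fourier_indicator K) y
      = complex_of_real ((2 * sqrt pi) ^ (DIM('a) - 1) * cone_moment (\<lambda>_. 1))"
    unfolding inversion_integral_def
    by (rule tendsto_Lim[OF trivial_limit_at_right_real tendsto_gauss_mean(1)])
  have "inversion_integral \<omega> (dir_deriv \<omega> (fourier_indicator K)) y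
      = - \<i> * complex_of_real ((2 * sqrt pi) ^ (DIM('a) - 1) * cone_moment (\<lambda>t. t))"
    unfolding inversion_integral_def
    by (rule tendsto_Lim[OF trivial_limit_at_right_real tendsto_gauss_mean(2)])
  then show "\<i> * inversion_integral \<omega> (dir_deriv \<omega> (fourier_indicator K)) y
      = complex_of_real (chord_mid \<omega> K y) * inversion_integral \<omega> (fourier_indicator K) y"
    by (simp add: 1 cone_moment_first flip: mult.assoc)
qed

lemma tendsto_gauss_mean_ratio:
  "((\<lambda>\<epsilon>. \<i> * gauss_mean \<omega> (dir_deriv \<omega> (fourier_indicator K)) y \<epsilon>
      / gauss_mean \<omega> (fourier_indicator K) y \<epsilon>)
    \<longlongrightarrow> complex_of_real (chord_mid \<omega> K y)) (at_right 0)"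
proof -
  have "((\<lambda>\<epsilon>. gauss_moment (\<lambda>t. t) \<epsilon> / gauss_moment (\<lambda>_. 1) \<epsilon>) \<longlongrightarrow> chord_mid \<omega> K y) (at_right 0)"
  proof (cases "a = b")
    case True
    then show ?thesis using gauss_moment_ratio_degenerate by (simp add: chord_mid_def)
  next
    case False
    then have pos: "cone_moment (\<lambda>_. 1) > 0" using chord(1) by (intro cone_moment_pos) simp
    have "((\<lambda>\<epsilon>. gauss_moment (\<lambda>t. t) \<epsilon> / gauss_moment (\<lambda>_. 1) \<epsilon>) \<longlongrightarrow>
        ((2 * sqrt pi) ^ (DIM('a) - 1) * cone_moment (\<lambda>t. t)) / ((2 * sqrt pi) ^ (DIM('a) - 1) * cone_moment (\<lambda>_. 1))) (at_right 0)"
      using pos by (intro tendsto_divide tendsto_gauss_moment) auto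
    then show ?thesis using pos by (simp add: cone_moment_first)
  qed
  then have "((\<lambda>\<epsilon>. complex_of_real (gauss_moment (\<lambda>t. t) \<epsilon> / gauss_moment (\<lambda>_. 1) \<epsilon>)) \<longlongrightarrow> complex_of_real (chord_mid \<omega> K y)) (at_right 0)"
    by (rule tendsto_of_real)
  moreover have "\<forall>\<^sub>F \<epsilon> in at_right 0. complex_of_real (gauss_moment (\<lambda>t. t) \<epsilon> / gauss_moment (\<lambda>_. 1) \<epsilon>)
      = \<i> * gauss_mean \<omega> (dir_deriv \<omega> (fourier_indicator K)) y \<epsilon> / gauss_mean \<omega> (fourier_indicator K) y \<epsilon>"
    using eventually_at_right_less[of "0::real"]
    by eventually_elim
      (simp add: gauss_mean_fourier_indicator gauss_mean_dir_deriv_fourier_indicator flip: mult.assoc)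
  ultimately show ?thesis by (rule Lim_transform_eventually)
qed

end

theorem theorem4p9:
  fixes K :: "(real ^ 'n) set" and \<omega> :: "real ^ 'n"
  assumes "CARD('n) \<ge> 2"
    and "convex_body K"
    and "\<omega> \<in> sphere 0 1"
  shows "\<forall>y\<in>shadow \<omega> K.
      inversion_integrable \<omega> (dir_deriv \<omega> (fourier_indicator K)) y \<and>
      inversion_integrable \<omega> (fourier_indicator K) y \<and>
      (lower_end \<omega> K y < upper_end \<omega> K y \<longrightarrow>
        inversion_integral \<omega> (fourier_indicator K) y \<noteq> 0 \<and>
        complex_of_real (chord_mid \<omega> K y) =
          \<i> * inversion_integral \<omega> (dir_deriv \<omega> (fourier_indicator K)) y
            / inversion_integral \<omega> (fourier_indicator K) y) \<and>
      ((\<lambda>\<epsilon>. \<i> * gauss_mean \<omega> (dir_deriv \<omega> (fourier_indicator K)) y \<epsilon>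
              / gauss_mean \<omega> (fourier_indicator K) y \<epsilon>)
        \<longlongrightarrow> complex_of_real (chord_mid \<omega> K y)) (at_right 0)"
proof
  fix y assume "y \<in> shadow \<omega> K"
  with assms interpret shadow_point K \<omega> y by unfold_locales auto
  have nz: "inversion_integral \<omega> (fourier_indicator K) y \<noteq> 0"
    if "lower_end \<omega> K y < upper_end \<omega> K y"
    using cone_moment_pos[OF that] unfolding inversion_integrals(3) by simp
  show "inversion_integrable \<omega> (dir_deriv \<omega> (fourier_indicator K)) y \<and>
      inversion_integrable \<omega> (fourier_indicator K) y \<and>
      (lower_end \<omega> K y < upper_end \<omega> K y \<longrightarrow>
        inversion_integral \<omega> (fourier_indicator K) y \<noteq> 0 \<and>
        complex_of_real (chord_mid \<omega> K y) =
          \<i> * inversion_integral \<omega> (dir_deriv \<omega> (fourier_indicator K)) y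
            / inversion_integral \<omega> (fourier_indicator K) y) \<and>
      ((\<lambda>\<epsilon>. \<i> * gauss_mean \<omega> (dir_deriv \<omega> (fourier_indicator K)) y \<epsilon>
              / gauss_mean \<omega> (fourier_indicator K) y \<epsilon>)
        \<longlongrightarrow> complex_of_real (chord_mid \<omega> K y)) (at_right 0)"
    using inversion_integrals(1,2) nz tendsto_gauss_mean_ratio
    unfolding inversion_integrals(4) by simp
qed

end
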